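(* Let $(V,\mu,\mathbf 1)$ be a right-unital associative algebra over a field $\Bbbk$, and let $\epsilon,\zeta$ be two algebra characters. (1) A bicomplex structure on $T(V)$ is defined by $${}^{\epsilon}d(v_1\ldots v_n)=\epsilon(v_1)v_2\ldots v_n+\sum_{i=1}^{n-1}(-1)^iv_1\ldots v_{i-1}\mu(v_i\otimes v_{i+1})v_{i+2}\ldots v_n,$$ $$d^{\zeta}(v_1\ldots v_n)=(-1)^{n-1}\zeta(v_n)v_1\ldots v_{n-1}+\sum_{i=0}^{n-2}(-1)^i\zeta(v_{i+1})\cdots\zeta(v_n)\,v_1\ldots v_i\,\mathbf 1\mathbf 1\ldots\mathbf 1$$ (with $n-1-i$ factors $\mathbf 1$ in the $i$-th term). (2) This bidifferential comes from the pre-bisimplicial structure $d_{n;1}(v_1\ldots v_n)=\epsilon(v_1)v_2\ldots v_n$; $d_{n;i+1}(v_1\ldots v_n)=v_1\ldots v_{i-1}\mu(v_i\otimes v_{i+1})v_{i+2}\ldots v_n$ for $1\le i\le n-1$; $d'_{n;i}(v_1\ldots v_n)=\zeta(v_i)\cdots\zeta(v_n)v_1\ldots v_{i-1}\mathbf 1\mathbf 1\ldots\mathbf 1$ (with $n-i$ factors $\mathbf 1$) for $1\le i\le n-1$; $d'_{n;n}(v_1\ldots v_n)=\zeta(v_n)v_1\ldots v_{n-1}$. (3) The complex $(T(V),{}^{\epsilon}d)$ is acyclic. (4) If $\mathbf 1$ is a two-sided unit, then the structure of (2) becomes weakly bisimplicial with $s_{n;i}(v_1\ldots v_n)=v_1\ldots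 v_{i-1}\mathbf 1v_i\ldots v_n$, $1\le i\le n$. (5) In this case $(T(V),d_{n;i},s_{n;i})$ is even simplicial. (6) (Still for $\mathbf 1$ two-sided.) In the normalized bicomplex, $d'_{n;i}=0$ for $i<n-1$. (7) Still supposing $\mathbf 1$ two-sided, the differential ${}^{\epsilon}d-d^{\zeta}$ descends to $T(V')$, where $V':=V/\Bbbk\mathbf 1$, giving the differential $${}^{\epsilon}d^{\zeta}(v_1\ldots v_n)=\epsilon(v_1)v_2\ldots v_n+\sum_{i=1}^{n-1}(-1)^iv_1\ldots v_{i-1}\mu(v_i\otimes v_{i+1})v_{i+2}\ldots v_n+(-1)^n\zeta(v_n)v_1\ldots v_{n-1}.$$
   Context: $T(V)=\bigoplus_{n\ge0}V^{\otimes n}$, $V^{\otimes0}=\Bbbk$, and $v_1\ldots v_n$ denotes $v_1\otimes\cdots\otimes v_n$; differentials vanish on $V^{\otimes 0}$. A right-unital associative algebra is a vector space $V$ with an associative bilinear product $\mu$ and an element $\mathbf 1$ with $\mu(v\otimes\mathbf 1)=v$ for all $v$. An algebra character is a linear form $\epsilon:V\to\Bbbk$ with $\epsilon(\mu(v\otimes w))=\epsilon(v)\epsilon(w)$ and $\epsilon(\mathbf 1)=1$. A bicomplex is a graded space with two anticommuting square-zero maps of degree $-1$. In (7), $T(V')$ is regarded as the quotient of $T(V)$ by the span of pure tensors having some factor equal to $\mathbf 1$, and the formula is computed on representatives in $T(V)$ and then projected. Simplicial vocabulary, for vector spaces $V_n$ ($n\ge0$; here $V_n=V^{\otimes n}$)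 with linear maps $d_{n;i},d'_{n;i}:V_n\to V_{n-1}$, $s_{n;i}:V_n\to V_{n+1}$, $1\le i\le n$ (first subscripts omitted, composites having source $V_n$): presimplicial: $d_id_j=d_{j-1}d_i$ for $1\le i<j\le n$; weakly simplicial: moreover $s_is_j=s_{j+1}s_i$ for $1\le i\le j\le n$, $d_is_j=s_{j-1}d_i$ for $1\le i<j\le n$, $d_is_j=s_jd_{i-1}$ for $1\le j$, $j+1<i\le n+1$, and $d_is_i=d_{i+1}s_i$ for $1\le i\le n$; simplicial: weakly simplicial and $d_is_i=\mathrm{Id}_{V_n}$ for $1\le i\le n$; pre-bisimplicial: $(V_n,d)$ and $(V_n,d')$ presimplicial and $d_id'_j=d'_{j-1}d_i$, $d'_id_j=d_{j-1}d'_i$ for $1\le i<j\le n$; the associated bidifferential is $\sum_i(-1)^{i-1}d_{n;i}$, $\sum_i(-1)^{i-1}d'_{n;i}$; weakly bisimplicial: pre-bisimplicial with $(V_n,d,s)$ and $(V_n,d',s)$ weakly simplicial. The normalized bicomplex is the quotient of $(V_n)$ by the degenerate sub-bicomplex $D_n=\sum_{i=1}^{n-1}s_{n-1;i}(V_{n-1})$; in (6), "$d'_{n;i}=0$" means that $d'_{n;i}$ has image in $D_{n-1}$. *)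

theory Defs
  imports Complex_Main "HOL-Library.Poly_Mapping"
begin

text \<open>
  A vector space over a field is a type carrying a scalar multiplication that satisfies the
  locale \<^locale>\<open>vector_space\<close>. Spaces that are genuinely smaller than a type (tensor powers,
  graded pieces) are subspaces of such an ambient vector space, and linear maps between them are
  functions whose values outside the source subspace are irrelevant.
\<close>

definition linear_map_on ::
  "('k::field \<Rightarrow> 't::ab_group_add \<Rightarrow> 't) \<Rightarrow> 't set \<Rightarrow> 't set \<Rightarrow> ('t \<Rightarrow> 't) \<Rightarrow> bool" where
  "linear_map_on sc A B f \<longleftrightarrow>
     f ` A \<subseteq> B \<and>
     (\<forall>x\<in>A. \<forall>y\<in>A. f (x + y) = f x + f y) \<and>
     (\<forall>c. \<forall>x\<in>A. f (sc c x) = sc c (f x))"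


section \<open>Right-unital associative algebras and characters\<close>

locale right_unital_algebra = vector_space scale
  for scale :: "'k::field \<Rightarrow> 'v::ab_group_add \<Rightarrow> 'v" +
  fixes mu :: "'v \<Rightarrow> 'v \<Rightarrow> 'v" and one :: 'v
  assumes linear_left: "Vector_Spaces.linear scale scale (\<lambda>v. mu v w)"
    and linear_right: "Vector_Spaces.linear scale scale (mu v)"
    and assoc: "mu (mu u v) w = mu u (mu v w)"
    and right_unit: "mu v one = v"

definition algebra_character ::
  "('k::field \<Rightarrow> 'v::ab_group_add \<Rightarrow> 'v) \<Rightarrow> ('v \<Rightarrow> 'v \<Rightarrow> 'v) \<Rightarrow> 'v \<Rightarrow> ('v \<Rightarrow> 'k) \<Rightarrow> bool" where
  "algebra_character scale mu one e \<longleftrightarrow>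
     Vector_Spaces.linear scale (*) e \<and> (\<forall>v w. e (mu v w) = e v * e w) \<and> e one = 1"


section \<open>The tensor algebra\<close>

text \<open>
  Finitely supported functions on words over \<open>V\<close> form the vector space freely spanned by
  the words. The space \<open>T(V)\<close> is its quotient by the multilinearity relations; words of different
  lengths are never related, and no relation involves the empty word.
\<close>

definition free_scale :: "'k::field \<Rightarrow> ('w \<Rightarrow>\<^sub>0 'k) \<Rightarrow> ('w \<Rightarrow>\<^sub>0 'k)" where
  "free_scale c x = Poly_Mapping.map ((*) c) x"

definition word :: "'w \<Rightarrow> ('w \<Rightarrow>\<^sub>0 'k::field)" where
  "word w = Poly_Mapping.single w 1"

definition multilinearity_relations ::
  "('k::field \<Rightarrow> 'v::ab_group_add \<Rightarrow> 'v) \<Rightarrow> ('v list \<Rightarrow>\<^sub>0 'k) set" where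
  "multilinearity_relations scale =
     module.span free_scale
       ({word (xs @ (u + v) # ys) - word (xs @ u # ys) - word (xs @ v # ys) | xs ys u v. True} \<union>
        {word (xs @ scale c v # ys) - free_scale c (word (xs @ v # ys)) | xs ys c v. True})"

text \<open>
  A realization of \<open>T(V)\<close>: a map \<open>tens\<close>, sending the list \<open>[v\<^sub>1, \<dots>, v\<^sub>n]\<close> to the pure tensor
  \<open>v\<^sub>1 \<otimes> \<dots> \<otimes> v\<^sub>n\<close>, whose linear extension to formal combinations of words has the
  multilinearity relations as its kernel. By the first isomorphism theorem the image of this linear
  extension, that is the span of the pure tensors, is the quotient defining \<open>T(V)\<close>. The
  ambient space may be larger than \<open>T(V)\<close>.
\<close>

locale tensor_algebra = vector_space scale + T: vector_space scaleT
  for scale :: "'k::field \<Rightarrow> 'v::ab_group_add \<Rightarrow> 'v"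
    and scaleT :: "'k \<Rightarrow> 't::ab_group_add \<Rightarrow> 't" +
  fixes tens :: "'v list \<Rightarrow> 't"
  assumes kernel: "(\<Sum>vs\<in>Poly_Mapping.keys x. scaleT (Poly_Mapping.lookup x vs) (tens vs)) = 0
                     \<longleftrightarrow> x \<in> multilinearity_relations scale"

definition tensor_power ::
  "('k::field \<Rightarrow> 't::ab_group_add \<Rightarrow> 't) \<Rightarrow> ('v list \<Rightarrow> 't) \<Rightarrow> nat \<Rightarrow> 't set" where
  "tensor_power scaleT tens n = module.span scaleT (tens ` {vs. length vs = n})"

definition tensor_space ::
  "('k::field \<Rightarrow> 't::ab_group_add \<Rightarrow> 't) \<Rightarrow> ('v list \<Rightarrow> 't) \<Rightarrow> 't set" where
  "tensor_space scaleT tens = module.span scaleT (range tens)"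


subsection \<open>Existence of realizations\<close>

lemma lookup_free_scale [simp]:
  "Poly_Mapping.lookup (free_scale c x) w = c * Poly_Mapping.lookup x w"
  by (simp add: free_scale_def Poly_Mapping.map.rep_eq when_def)

lemma vector_space_free_scale: "vector_space free_scale"
  by unfold_locales (rule poly_mapping_eqI, simp add: lookup_add algebra_simps)+

lemma free_expansion:
  "(\<Sum>w\<in>Poly_Mapping.keys x. free_scale (Poly_Mapping.lookup x w) (word w)) = x"
proof (rule poly_mapping_eqI)
  fix k
  have "(\<Sum>w\<in>Poly_Mapping.keys x. Poly_Mapping.lookup x w * (if w = k then 1 else 0))
      = (\<Sum>w\<in>Poly_Mapping.keys x. if w = k then Poly_Mapping.lookup x w else 0)"
    by (rule sum.cong) auto
  then show "Poly_Mapping.lookup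
      (\<Sum>w\<in>Poly_Mapping.keys x. free_scale (Poly_Mapping.lookup x w) (word w)) k =
        Poly_Mapping.lookup x k"
    by (simp add: lookup_sum word_def lookup_single when_def in_keys_iff)
qed

theorem tensor_algebra_exists:
  fixes scale :: "'k::field \<Rightarrow> 'v::ab_group_add \<Rightarrow> 'v"
  assumes "vector_space scale"
  shows "\<exists>tens :: 'v list \<Rightarrow> ('v list \<Rightarrow>\<^sub>0 'k). tensor_algebra scale free_scale tens"
proof -
  interpret V: vector_space scale by fact
  interpret F: vector_space "free_scale :: 'k \<Rightarrow> ('v list \<Rightarrow>\<^sub>0 'k) \<Rightarrow> _"
    by (rule vector_space_free_scale)
  interpret FF: vector_space_pair "free_scale :: 'k \<Rightarrow> ('v list \<Rightarrow>\<^sub>0 'k) \<Rightarrow> _"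
      "free_scale :: 'k \<Rightarrow> ('v list \<Rightarrow>\<^sub>0 'k) \<Rightarrow> _" ..
  let ?R = "multilinearity_relations scale"
  have sR: "F.subspace ?R"
    unfolding multilinearity_relations_def by (rule F.subspace_span)
  obtain B where B: "B \<subseteq> ?R" "F.independent B" "?R \<subseteq> F.span B"
    using F.maximal_independent_subset[of ?R] by blast
  have spanB: "F.span B = ?R"
    using B sR by (simp add: F.span_subspace)
  define C where "C = F.extend_basis B"
  have C: "B \<subseteq> C" "F.independent C" "F.span C = UNIV"
    unfolding C_def using B(2)
    by (auto simp: F.extend_basis_superset F.independent_extend_basis)
  obtain p where p: "Vector_Spaces.linear free_scale free_scale p"
    and pC: "\<forall>b\<in>C. p b = (if b \<in> B then 0 else b)"
    using FF.linear_independent_extend[OF C(2), of "\<lambda>b. if b \<in> B then 0 else b"] by blast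
  interpret p: Vector_Spaces.linear free_scale free_scale p by (rule p)
  have pB: "p x = 0" if "x \<in> F.span B" for x
    using that by (rule p.eq_0_on_span[rotated]) (use pC C(1) in auto)
  have pD: "p x = x" if "x \<in> F.span (C - B)" for x
  proof -
    have "p x = id x"
      by (rule FF.linear_eq_on[OF p F.linear_id that]) (use pC in auto)
    then show ?thesis by simp
  qed
  have ker: "p x = 0 \<longleftrightarrow> x \<in> ?R" for x
  proof
    assume 0: "p x = 0"
    have "x \<in> F.span (B \<union> (C - B))"
      using C by (simp add: Un_absorb1)
    then obtain y z where yz: "x = y + z" "y \<in> F.span B" "z \<in> F.span (C - B)"
      unfolding F.span_Un by auto
    then have "p x = z" by (simp add: p.add pB pD)
    with 0 yz show "x \<in> ?R" by (simp add: spanB)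
  qed (simp add: pB spanB)
  have ext: "(\<Sum>vs\<in>Poly_Mapping.keys x.
      free_scale (Poly_Mapping.lookup x vs) ((p \<circ> word) vs)) = p x" for x
    using arg_cong[OF free_expansion, of p x] by (simp add: p.sum p.scale)
  have "tensor_algebra scale free_scale (p \<circ> word)"
    by unfold_locales (simp only: ext ker)
  then show ?thesis by blast
qed


section \<open>Graded spaces, bicomplexes and simplicial structures\<close>

definition graded_space ::
  "('k::field \<Rightarrow> 't::ab_group_add \<Rightarrow> 't) \<Rightarrow> (nat \<Rightarrow> 't set) \<Rightarrow> 't set \<Rightarrow> bool" where
  "graded_space sc V W \<longleftrightarrow>
     (\<forall>n. module.subspace sc (V n)) \<and>
     W = module.span sc (\<Union>n. V n) \<and>
     (\<forall>x N. (\<forall>n. x n \<in> V n) \<longrightarrow> (\<Sum>n<N. x n) = 0 \<longrightarrow> (\<forall>n<N. x n = 0))"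

definition degree_minus_one ::
  "('k::field \<Rightarrow> 't::ab_group_add \<Rightarrow> 't) \<Rightarrow> (nat \<Rightarrow> 't set) \<Rightarrow> 't set \<Rightarrow> ('t \<Rightarrow> 't) \<Rightarrow> bool" where
  "degree_minus_one sc V W f \<longleftrightarrow>
     linear_map_on sc W W f \<and> (\<forall>n. f ` V (Suc n) \<subseteq> V n) \<and> f ` V 0 \<subseteq> {0}"

definition bicomplex ::
  "('k::field \<Rightarrow> 't::ab_group_add \<Rightarrow> 't) \<Rightarrow> (nat \<Rightarrow> 't set) \<Rightarrow> 't set \<Rightarrow>
     ('t \<Rightarrow> 't) \<Rightarrow> ('t \<Rightarrow> 't) \<Rightarrow> bool" where
  "bicomplex sc V W f g \<longleftrightarrow>
     graded_space sc V W \<and> degree_minus_one sc V W f \<and> degree_minus_one sc V W g \<and>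
     (\<forall>x\<in>W. f (f x) = 0 \<and> g (g x) = 0 \<and> f (g x) = - g (f x))"

text \<open>Vanishing homology in every degree, including degree \<open>0\<close>.\<close>

definition acyclic_complex ::
  "(nat \<Rightarrow> 't::ab_group_add set) \<Rightarrow> ('t \<Rightarrow> 't) \<Rightarrow> bool" where
  "acyclic_complex V f \<longleftrightarrow> (\<forall>n. {x \<in> V n. f x = 0} = f ` V (Suc n))"

text \<open>
  In the following, \<open>d n i\<close> stands for the map with indices \<open>n;i\<close>; only the indices
  \<open>1 \<le> i \<le> n\<close> are meaningful.
\<close>

definition presimplicial ::
  "('k::field \<Rightarrow> 't::ab_group_add \<Rightarrow> 't) \<Rightarrow> (nat \<Rightarrow> 't set) \<Rightarrow>
     (nat \<Rightarrow> nat \<Rightarrow> 't \<Rightarrow> 't) \<Rightarrow> bool" where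
  "presimplicial sc V d \<longleftrightarrow>
     (\<forall>n. module.subspace sc (V n)) \<and>
     (\<forall>n i. 1 \<le> i \<and> i \<le> n \<longrightarrow> linear_map_on sc (V n) (V (n - 1)) (d n i)) \<and>
     (\<forall>n i j. 1 \<le> i \<and> i < j \<and> j \<le> n \<longrightarrow>
        (\<forall>x\<in>V n. d (n - 1) i (d n j x) = d (n - 1) (j - 1) (d n i x)))"

definition weakly_simplicial ::
  "('k::field \<Rightarrow> 't::ab_group_add \<Rightarrow> 't) \<Rightarrow> (nat \<Rightarrow> 't set) \<Rightarrow>
     (nat \<Rightarrow> nat \<Rightarrow> 't \<Rightarrow> 't) \<Rightarrow> (nat \<Rightarrow> nat \<Rightarrow> 't \<Rightarrow> 't) \<Rightarrow> bool" where
  "weakly_simplicial sc V d s \<longleftrightarrow>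
     presimplicial sc V d \<and>
     (\<forall>n i. 1 \<le> i \<and> i \<le> n \<longrightarrow> linear_map_on sc (V n) (V (n + 1)) (s n i)) \<and>
     (\<forall>n i j. 1 \<le> i \<and> i \<le> j \<and> j \<le> n \<longrightarrow>
        (\<forall>x\<in>V n. s (n + 1) i (s n j x) = s (n + 1) (j + 1) (s n i x))) \<and>
     (\<forall>n i j. 1 \<le> i \<and> i < j \<and> j \<le> n \<longrightarrow>
        (\<forall>x\<in>V n. d (n + 1) i (s n j x) = s (n - 1) (j - 1) (d n i x))) \<and>
     (\<forall>n i j. 1 \<le> j \<and> j + 1 < i \<and> i \<le> n + 1 \<longrightarrow>
        (\<forall>x\<in>V n. d (n + 1) i (s n j x) = s (n - 1) j (d n (i - 1) x))) \<and>
     (\<forall>n i. 1 \<le> i \<and> i \<le> n \<longrightarrow>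
        (\<forall>x\<in>V n. d (n + 1) i (s n i x) = d (n + 1) (i + 1) (s n i x)))"

definition simplicial ::
  "('k::field \<Rightarrow> 't::ab_group_add \<Rightarrow> 't) \<Rightarrow> (nat \<Rightarrow> 't set) \<Rightarrow>
     (nat \<Rightarrow> nat \<Rightarrow> 't \<Rightarrow> 't) \<Rightarrow> (nat \<Rightarrow> nat \<Rightarrow> 't \<Rightarrow> 't) \<Rightarrow> bool" where
  "simplicial sc V d s \<longleftrightarrow>
     weakly_simplicial sc V d s \<and>
     (\<forall>n i. 1 \<le> i \<and> i \<le> n \<longrightarrow> (\<forall>x\<in>V n. d (n + 1) i (s n i x) = x))"

definition pre_bisimplicial ::
  "('k::field \<Rightarrow> 't::ab_group_add \<Rightarrow> 't) \<Rightarrow> (nat \<Rightarrow> 't set) \<Rightarrow>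
     (nat \<Rightarrow> nat \<Rightarrow> 't \<Rightarrow> 't) \<Rightarrow> (nat \<Rightarrow> nat \<Rightarrow> 't \<Rightarrow> 't) \<Rightarrow> bool" where
  "pre_bisimplicial sc V d d' \<longleftrightarrow>
     presimplicial sc V d \<and> presimplicial sc V d' \<and>
     (\<forall>n i j. 1 \<le> i \<and> i < j \<and> j \<le> n \<longrightarrow>
        (\<forall>x\<in>V n. d (n - 1) i (d' n j x) = d' (n - 1) (j - 1) (d n i x) \<and>
                  d' (n - 1) i (d n j x) = d (n - 1) (j - 1) (d' n i x)))"

definition weakly_bisimplicial ::
  "('k::field \<Rightarrow> 't::ab_group_add \<Rightarrow> 't) \<Rightarrow> (nat \<Rightarrow> 't set) \<Rightarrow>
     (nat \<Rightarrow> nat \<Rightarrow> 't \<Rightarrow> 't) \<Rightarrow> (nat \<Rightarrow> nat \<Rightarrow> 't \<Rightarrow> 't) \<Rightarrow> (nat \<Rightarrow> nat \<Rightarrow> 't \<Rightarrow> 't) \<Rightarrow> bool" where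
  "weakly_bisimplicial sc V d d' s \<longleftrightarrow>
     pre_bisimplicial sc V d d' \<and> weakly_simplicial sc V d s \<and> weakly_simplicial sc V d' s"

definition alternating_sum ::
  "('k::field \<Rightarrow> 't::ab_group_add \<Rightarrow> 't) \<Rightarrow> (nat \<Rightarrow> nat \<Rightarrow> 't \<Rightarrow> 't) \<Rightarrow> nat \<Rightarrow> 't \<Rightarrow> 't" where
  "alternating_sum sc d n x = (\<Sum>i=1..n. sc ((-1) ^ (i - 1)) (d n i x))"

definition degenerate ::
  "('k::field \<Rightarrow> 't::ab_group_add \<Rightarrow> 't) \<Rightarrow> (nat \<Rightarrow> 't set) \<Rightarrow>
     (nat \<Rightarrow> nat \<Rightarrow> 't \<Rightarrow> 't) \<Rightarrow> nat \<Rightarrow> 't set" where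
  "degenerate sc V s n = module.span sc (\<Union>i\<in>{1..n - 1}. s (n - 1) i ` V (n - 1))"

definition sub_bicomplex ::
  "('k::field \<Rightarrow> 't::ab_group_add \<Rightarrow> 't) \<Rightarrow> (nat \<Rightarrow> 't set) \<Rightarrow> (nat \<Rightarrow> 't set) \<Rightarrow>
     ('t \<Rightarrow> 't) \<Rightarrow> ('t \<Rightarrow> 't) \<Rightarrow> bool" where
  "sub_bicomplex sc V D f g \<longleftrightarrow>
     (\<forall>n. module.subspace sc (D n) \<and> D n \<subseteq> V n \<and> f ` D (Suc n) \<subseteq> D n \<and> g ` D (Suc n) \<subseteq> D n)"


section \<open>Operations on words and reduced tensors\<close>

text \<open>
  Lists are indexed from \<open>0\<close>, so the factor \<open>v\<^sub>i\<close> is \<open>vs ! (i - 1)\<close>. The word below is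
  \<open>v\<^sub>1 \<dots> v\<^bsub>i-1\<^esub> \<mu>(v\<^sub>i \<otimes> v\<^bsub>i+1\<^esub>) v\<^bsub>i+2\<^esub> \<dots> v\<^sub>n\<close> for \<open>1 \<le> i < n\<close>.
\<close>

definition multiply_at :: "('v \<Rightarrow> 'v \<Rightarrow> 'v) \<Rightarrow> nat \<Rightarrow> 'v list \<Rightarrow> 'v list" where
  "multiply_at mu i vs = take (i - 1) vs @ mu (vs ! (i - 1)) (vs ! i) # drop (i + 1) vs"

text \<open>
  For \<open>V' = V/k\<one>\<close>, the space \<open>T(V')\<close> is the set of cosets in \<open>T(V)\<close> of the span of
  the pure tensors with some factor \<open>\<one>\<close>; \<open>reduced_class\<close> is the projection.
\<close>

definition unit_tensors ::
  "('k::field \<Rightarrow> 't::ab_group_add \<Rightarrow> 't) \<Rightarrow> ('v list \<Rightarrow> 't) \<Rightarrow> 'v \<Rightarrow> 't set" where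
  "unit_tensors scaleT tens one = module.span scaleT (tens ` {vs. one \<in> set vs})"

definition reduced_class ::
  "('k::field \<Rightarrow> 't::ab_group_add \<Rightarrow> 't) \<Rightarrow> ('v list \<Rightarrow> 't) \<Rightarrow> 'v \<Rightarrow> 't \<Rightarrow> 't set" where
  "reduced_class scaleT tens one x =
     {y \<in> tensor_space scaleT tens. y - x \<in> unit_tensors scaleT tens one}"

end

theory Submission
  imports Defs
begin

text \<open>
  The face maps and degeneracies are determined by their values on pure tensors, and they send a word
  to a multiple of another word. Such a prescription defines a linear map as soon as it is
  linear in each letter (\<open>universal_property\<close>), and an identity between composites of such maps amounts
  to an identity of words and an identity of scalars (\<open>word_operator_comp_eqI\<close>). The identities of
  words are checked letter by letter; the identities of scalars hold because \<open>\<epsilon>\<close> and \<open>\<zeta>\<close> are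
  multiplicative and take the value \<open>1\<close> on the unit. This gives the pre-bisimplicial structure.

  The bicomplex follows by a general argument: in the composite of two alternating sums, the terms with
  indices \<open>i < j\<close> and \<open>(j - 1, i)\<close> agree up to sign, so the two halves of the double sum cancel
  (\<open>alternating_exchange\<close>).

  Acyclicity comes from the homotopy \<open>w \<mapsto> w \<one>\<close>. The unit is appended on the right because a right unit
  is absorbed by the letter on its left: the last face undoes the homotopy, and all other faces commute
  with it (\<open>append_unit_homotopy\<close>).

  If \<open>\<one>\<close> is a two-sided unit, inserting it gives the degeneracies. The degenerate tensors are stable under
  both differentials, since the two faces that meet an inserted unit cancel
  (\<open>weakly_simplicial_degenerate_stable\<close>). The quotient \<open>T(V')\<close> is smaller than the normalized
  bicomplex, because words ending in \<open>\<one>\<close> are killed as well. On a word \<open>w \<one>\<close> each differential has a term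
  \<open>\<plusminus>w\<close> with the same sign, so it is the difference of the two differentials that descends
  (\<open>total_differential_unit_tensors\<close>).
\<close>


section \<open>Linear maps out of the tensor algebra\<close>

text \<open>
  Linearity in one letter is expressed by updating the list at one position: an operation on words
  then has to be compared only with the updates \<open>vs[k := u]\<close>.
\<close>

definition multilinear ::
  "('k::field \<Rightarrow> 'v::ab_group_add \<Rightarrow> 'v) \<Rightarrow> ('k \<Rightarrow> 't::ab_group_add \<Rightarrow> 't) \<Rightarrow> nat \<Rightarrow> ('v list \<Rightarrow> 't) \<Rightarrow> bool" where
  "multilinear scale scaleT n f \<longleftrightarrow>
    (\<forall>vs k. length vs = n \<and> k < n \<longrightarrow>
       Vector_Spaces.linear scale scaleT (\<lambda>u. f (vs[k := u])))"

lemma linear_mapI: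
  assumes "vector_space s1" "vector_space s2"
    and "\<And>x y. f (x + y) = f x + f y" "\<And>c x. f (s1 c x) = s2 c (f x)"
  shows "Vector_Spaces.linear s1 s2 f"
  unfolding Vector_Spaces.linear_iff by (intro conjI allI assms)

context tensor_algebra
begin

text \<open>
  The linear extension of a function on words to the free vector space on the words; for \<open>tens\<close>
  its kernel is what the axiom of \<^locale>\<open>tensor_algebra\<close> prescribes.
\<close>

definition extend :: "('v list \<Rightarrow> 't) \<Rightarrow> ('v list \<Rightarrow>\<^sub>0 'k) \<Rightarrow> 't" where
  "extend f x = (\<Sum>vs\<in>Poly_Mapping.keys x. scaleT (Poly_Mapping.lookup x vs) (f vs))"

lemma extend_superset:
  assumes "finite S" "Poly_Mapping.keys x \<subseteq> S"
  shows "extend f x = (\<Sum>vs\<in>S. scaleT (Poly_Mapping.lookup x vs) (f vs))"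
  unfolding extend_def using assms by (intro sum.mono_neutral_left) (auto simp: in_keys_iff)

lemma extend_linear: "Vector_Spaces.linear free_scale scaleT (extend f)"
proof -
  interpret F: vector_space free_scale
    by (rule vector_space_free_scale)
  show ?thesis
  proof (rule linear_mapI)
    fix x y :: "'v list \<Rightarrow>\<^sub>0 'k" and c :: 'k
    have "Poly_Mapping.keys (x + y) \<subseteq> Poly_Mapping.keys x \<union> Poly_Mapping.keys y"
      by (rule Poly_Mapping.keys_add)
    then show "extend f (x + y) = extend f x + extend f y"
      by (subst (1 2 3) extend_superset[of "Poly_Mapping.keys x \<union> Poly_Mapping.keys y"])
        (auto simp: lookup_add T.scale_left_distrib sum.distrib)
    have "Poly_Mapping.keys (free_scale c x) \<subseteq> Poly_Mapping.keys x"
      by (auto simp: in_keys_iff)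
    then show "extend f (free_scale c x) = scaleT c (extend f x)"
      by (subst (1 2) extend_superset[of "Poly_Mapping.keys x"])
        (auto simp: T.scale_sum_right)
  qed (fact vector_space_free_scale T.vector_space_axioms)+
qed

lemma extend_word [simp]: "extend f (word vs) = f vs"
  by (simp add: extend_def word_def)

lemma extend_tens_eq_0: "extend tens x = 0 \<longleftrightarrow> x \<in> multilinearity_relations scale"
  using kernel[of x] by (simp add: extend_def)

lemma tens_multilinear: "multilinear scale scaleT n tens"
proof -
  interpret F: vector_space "free_scale :: 'k \<Rightarrow> ('v list \<Rightarrow>\<^sub>0 'k) \<Rightarrow> _"
    by (rule vector_space_free_scale)
  interpret E: Vector_Spaces.linear free_scale scaleT "extend tens"
    by (rule extend_linear)
  show ?thesis unfolding multilinear_def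
  proof (intro allI impI linear_mapI)
    fix vs k u v c assume "length (vs :: 'v list) = n \<and> k < n"
    then have upd: "vs[k := w] = take k vs @ w # drop (Suc k) vs" for w
      by (simp add: upd_conv_take_nth_drop)
    have "word (take k vs @ (u + v) # drop (Suc k) vs)
        - word (take k vs @ u # drop (Suc k) vs)
        - word (take k vs @ v # drop (Suc k) vs) \<in> multilinearity_relations scale"
      unfolding multilinearity_relations_def by (rule F.span_base) blast
    from this[folded extend_tens_eq_0]
    show "tens (vs[k := u + v]) = tens (vs[k := u]) + tens (vs[k := v])"
      by (simp add: upd E.diff diff_eq_eq add.commute)
    have "word (take k vs @ scale c v # drop (Suc k) vs)
        - free_scale c (word (take k vs @ v # drop (Suc k) vs)) \<in> multilinearity_relations scale"
      unfolding multilinearity_relations_def by (rule F.span_base) blast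
    from this[folded extend_tens_eq_0]
    show "tens (vs[k := scale c v]) = scaleT c (tens (vs[k := v]))"
      by (simp add: upd E.diff E.scale)
  qed (auto intro: vector_space_axioms T.vector_space_axioms)
qed

text \<open>
  The linear extension of a multilinear \<open>f\<close> kills the multilinearity relations, hence the kernel of
  the extension of \<open>tens\<close>. A linear section of the latter, followed by the extension of \<open>f\<close>,
  is therefore independent of the section on pure tensors. Choosing the section on the whole
  ambient space gives a map that is linear everywhere, not only on the tensor space.
\<close>

theorem universal_property:
  assumes f: "\<And>n. multilinear scale scaleT n f"
  obtains L where "Vector_Spaces.linear scaleT scaleT L" "\<And>vs. L (tens vs) = f vs"
proof -
  interpret F: vector_space "free_scale :: 'k \<Rightarrow> ('v list \<Rightarrow>\<^sub>0 'k) \<Rightarrow> _"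
    by (rule vector_space_free_scale)
  interpret P: vector_space_pair "free_scale :: 'k \<Rightarrow> ('v list \<Rightarrow>\<^sub>0 'k) \<Rightarrow> _" scaleT ..
  interpret E: Vector_Spaces.linear free_scale scaleT "extend tens"
    by (rule extend_linear)
  interpret G: Vector_Spaces.linear free_scale scaleT "extend f"
    by (rule extend_linear)
  have f_add: "f (xs @ (u + v) # ys) = f (xs @ u # ys) + f (xs @ v # ys)"
   and f_scale: "f (xs @ scale c v # ys) = scaleT c (f (xs @ v # ys))" for xs ys u v c
  proof -
    have "Vector_Spaces.linear scale scaleT (\<lambda>w. f ((xs @ u # ys)[length xs := w]))"
      by (rule f[of "length (xs @ u # ys)", unfolded multilinear_def, rule_format]) simp
    then interpret S: Vector_Spaces.linear scale scaleT "\<lambda>w. f (xs @ w # ys)"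
      by simp
    show "f (xs @ (u + v) # ys) = f (xs @ u # ys) + f (xs @ v # ys)" by (rule S.add)
    show "f (xs @ scale c v # ys) = scaleT c (f (xs @ v # ys))" by (rule S.scale)
  qed
  have rel: "extend f x = 0" if "x \<in> multilinearity_relations scale" for x
    using that unfolding multilinearity_relations_def
    by (rule G.eq_0_on_span[rotated]) (auto simp: G.diff G.scale f_add f_scale)
  have "T.span (range (extend tens)) \<subseteq> extend tens ` F.span UNIV"
    using E.subspace_image[OF F.subspace_UNIV] by (simp add: T.span_minimal)
  from P.linear_surj_right_inverse[OF extend_linear this]
  obtain \<sigma> where \<sigma>: "Vector_Spaces.linear scaleT free_scale \<sigma>"
    and sec: "\<And>y. y \<in> T.span (range (extend tens)) \<Longrightarrow> extend tens (\<sigma> y) = y"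
    by (elim exE conjE) simp
  show thesis
  proof
    show "Vector_Spaces.linear scaleT scaleT (extend f \<circ> \<sigma>)"
      by (rule Vector_Spaces.linear_compose[OF \<sigma> extend_linear])
    fix vs
    have "tens vs \<in> T.span (range (extend tens))"
      by (intro T.span_base range_eqI[where x = "word vs"]) simp
    then have "extend tens (\<sigma> (tens vs) - word vs) = 0"
      by (simp add: E.diff sec)
    then have "extend f (\<sigma> (tens vs) - word vs) = 0"
      by (simp add: extend_tens_eq_0 rel)
    then show "(extend f \<circ> \<sigma>) (tens vs) = f vs" by (simp add: G.diff)
  qed
qed

text \<open>
  Multilinearity concerns words of one length at a time, so a function may be extended by zero to the
  words of all other lengths.
\<close>

lemma lift_multilinear:
  assumes f: "multilinear scale scaleT n f"
  obtains L where "Vector_Spaces.linear scaleT scaleT L"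
    "\<And>vs. length vs = n \<Longrightarrow> L (tens vs) = f vs"
proof -
  have zero: "Vector_Spaces.linear scale scaleT (\<lambda>_. 0)"
    by (rule linear_mapI) (simp_all add: vector_space_axioms T.vector_space_axioms)
  have "multilinear scale scaleT m (\<lambda>vs. if length vs = n then f vs else 0)" for m
    using f zero by (cases "m = n") (auto simp: multilinear_def)
  then obtain L where "Vector_Spaces.linear scaleT scaleT L"
    "\<And>vs. L (tens vs) = (if length vs = n then f vs else 0)"
    using universal_property[of "\<lambda>vs. if length vs = n then f vs else 0"] by metis
  then show thesis by (intro that) auto
qed

lemma tens_in_power: "length vs = n \<Longrightarrow> tens vs \<in> tensor_power scaleT tens n"
  unfolding tensor_power_def by (intro T.span_base) auto

lemma subspace_power: "T.subspace (tensor_power scaleT tens n)"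
  by (simp add: tensor_power_def)

lemma linear_eq_on_power:
  assumes "Vector_Spaces.linear scaleT scaleT f" "Vector_Spaces.linear scaleT scaleT g"
    and "\<And>vs. length vs = n \<Longrightarrow> f (tens vs) = g (tens vs)" "x \<in> tensor_power scaleT tens n"
  shows "f x = g x"
proof -
  interpret P: vector_space_pair scaleT scaleT ..
  show ?thesis
    by (rule P.linear_eq_on[OF assms(1,2) assms(4)[unfolded tensor_power_def]]) (use assms(3) in auto)
qed

lemma linear_image_power:
  assumes "Vector_Spaces.linear scaleT scaleT f" "T.subspace W"
    and "\<And>vs. length vs = n \<Longrightarrow> f (tens vs) \<in> W"
  shows "f ` tensor_power scaleT tens n \<subseteq> W"
proof -
  interpret f: Vector_Spaces.linear scaleT scaleT f by fact
  have "f ` tensor_power scaleT tens n = T.span (f ` tens ` {vs. length vs = n})"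
    by (simp add: tensor_power_def f.span_image)
  also have "\<dots> \<subseteq> W" using assms(2,3) by (intro T.span_minimal) auto
  finally show ?thesis .
qed

text \<open>
  Maps given degree by degree define one map on the tensor space, because on a pure tensor the
  degree can be read off from the word. With identities and zero maps this also provides the
  projections to the homogeneous components.
\<close>

lemma glue_linear:
  assumes F: "\<And>n. Vector_Spaces.linear scaleT scaleT (F n)"
  obtains L where "Vector_Spaces.linear scaleT scaleT L"
    "\<And>n x. x \<in> tensor_power scaleT tens n \<Longrightarrow> L x = F n x"
proof -
  have "Vector_Spaces.linear scale scaleT (\<lambda>u. F n (g u))"
    if "Vector_Spaces.linear scale scaleT g" for n g
    using Vector_Spaces.linear_compose[OF that F] by (simp add: comp_def)
  then have "multilinear scale scaleT n (\<lambda>vs. F (length vs) (tens vs))" for n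
    using tens_multilinear[of n] by (simp add: multilinear_def)
  then obtain L where L: "Vector_Spaces.linear scaleT scaleT L"
    "\<And>vs. L (tens vs) = F (length vs) (tens vs)"
    using universal_property[of "\<lambda>vs. F (length vs) (tens vs)"] by metis
  show thesis
    by (rule that[OF L(1) linear_eq_on_power[OF L(1) F]]) (auto simp: L(2))
qed

lemma tensor_space_eq_span_powers:
  "tensor_space scaleT tens = T.span (\<Union>n. tensor_power scaleT tens n)"
proof (rule T.span_eq[THEN iffD2, of "range tens", folded tensor_space_def], intro conjI)
  show "range tens \<subseteq> T.span (\<Union>n. tensor_power scaleT tens n)"
    by (auto intro!: T.span_base tens_in_power)
  show "(\<Union>n. tensor_power scaleT tens n) \<subseteq> tensor_space scaleT tens"
    unfolding tensor_power_def tensor_space_def by (auto intro: T.span_mono[THEN subsetD, rotated])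
qed

lemma graded_tensor_space:
  "graded_space scaleT (tensor_power scaleT tens) (tensor_space scaleT tens)"
  unfolding graded_space_def
proof (intro conjI allI impI)
  fix x :: "nat \<Rightarrow> 't" and N n
  assume x: "\<forall>n. x n \<in> tensor_power scaleT tens n" and 0: "(\<Sum>n<N. x n) = 0" and n: "n < N"
  have "Vector_Spaces.linear scaleT scaleT (if m = n then id else (\<lambda>_. 0))" for m
    by (rule linear_mapI) (simp_all add: T.vector_space_axioms)
  then obtain L where L: "Vector_Spaces.linear scaleT scaleT L"
    and pr: "\<And>m x. x \<in> tensor_power scaleT tens m \<Longrightarrow> L x = (if m = n then id else (\<lambda>_. 0)) x"
    using glue_linear[of "\<lambda>m. if m = n then id else (\<lambda>_. 0)"] by metis
  interpret L: Vector_Spaces.linear scaleT scaleT L by (rule L)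
  have "L (\<Sum>m<N. x m) = (\<Sum>m<N. if m = n then x m else 0)"
    unfolding L.sum using pr[OF x[rule_format]] by (intro sum.cong) auto
  with 0 n show "x n = 0" by simp
qed (simp_all add: subspace_power tensor_space_eq_span_powers)

end

section \<open>Alternating sums of simplicial families\<close>

lemma alternating_sum_0 [simp]: "alternating_sum sc d 0 x = 0"
  by (simp add: alternating_sum_def)

lemma linear_map_on_mem: "linear_map_on sc A B f \<Longrightarrow> x \<in> A \<Longrightarrow> f x \<in> B"
  by (auto simp: linear_map_on_def)

lemma presimplicialD:
  assumes "presimplicial sc V d"
  shows "module.subspace sc (V n)"
    and "1 \<le> i \<Longrightarrow> i \<le> n \<Longrightarrow> linear_map_on sc (V n) (V (n - 1)) (d n i)"
    and "1 \<le> i \<Longrightarrow> i < j \<Longrightarrow> j \<le> n \<Longrightarrow> x \<in> V n \<Longrightarrow> d (n - 1) i (d n j x) = d (n - 1) (j - 1) (d n i x)"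
  using assms by (simp_all add: presimplicial_def)

lemma weakly_simplicialD:
  assumes "weakly_simplicial sc V d s"
  shows "presimplicial sc V d"
    and "1 \<le> i \<Longrightarrow> i \<le> n \<Longrightarrow> linear_map_on sc (V n) (V (n + 1)) (s n i)"
    and "1 \<le> i \<Longrightarrow> i < j \<Longrightarrow> j \<le> n \<Longrightarrow> x \<in> V n \<Longrightarrow> d (n + 1) i (s n j x) = s (n - 1) (j - 1) (d n i x)"
    and "1 \<le> j \<Longrightarrow> j + 1 < i \<Longrightarrow> i \<le> n + 1 \<Longrightarrow> x \<in> V n \<Longrightarrow> d (n + 1) i (s n j x) = s (n - 1) j (d n (i - 1) x)"
    and "1 \<le> i \<Longrightarrow> i \<le> n \<Longrightarrow> x \<in> V n \<Longrightarrow> d (n + 1) i (s n i x) = d (n + 1) (i + 1) (s n i x)"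
  using assms by (simp_all add: weakly_simplicial_def)

context vector_space
begin

lemma linear_map_on_sum:
  assumes f: "linear_map_on scale A B f" and A: "subspace A"
    and "finite I" "\<And>i. i \<in> I \<Longrightarrow> x i \<in> A"
  shows "f (\<Sum>i\<in>I. scale (c i) (x i)) = (\<Sum>i\<in>I. scale (c i) (f (x i)))"
  using assms(3,4)
proof (induction rule: finite_induct)
  case empty
  have "f (scale 0 0) = scale 0 (f 0)"
    using f subspace_0[OF A] unfolding linear_map_on_def by blast
  then show ?case by simp
next
  case (insert i I)
  have "scale (c i) (x i) \<in> A" "(\<Sum>i\<in>I. scale (c i) (x i)) \<in> A"
    using insert.prems by (auto intro!: subspace_sum[OF A] subspace_scale[OF A])
  then have "f (scale (c i) (x i) + (\<Sum>i\<in>I. scale (c i) (x i))) =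
      scale (c i) (f (x i)) + f (\<Sum>i\<in>I. scale (c i) (x i))"
    using f insert.prems unfolding linear_map_on_def by auto
  then show ?case using insert by simp
qed

lemma linear_map_on_alternating_sum:
  assumes d: "\<And>i. 1 \<le> i \<Longrightarrow> i \<le> n \<Longrightarrow> linear_map_on scale (V n) W (d n i)"
    and W: "subspace W"
  shows "linear_map_on scale (V n) W (alternating_sum scale d n)"
  unfolding linear_map_on_def
proof (intro conjI ballI allI)
  show "alternating_sum scale d n ` V n \<subseteq> W"
    using linear_map_on_mem[OF d] unfolding alternating_sum_def
    by (auto intro!: subspace_sum[OF W] subspace_scale[OF W])
  have *: "\<forall>i\<in>{1..n}. d n i (x + y) = d n i x + d n i y \<and> d n i (scale c x) = scale c (d n i x)"
    if "x \<in> V n" "y \<in> V n" for x y c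
    using d that by (auto simp: linear_map_on_def)
  show "alternating_sum scale d n (x + y) = alternating_sum scale d n x + alternating_sum scale d n y"
    if "x \<in> V n" "y \<in> V n" for x y
    using *[OF that] by (simp add: alternating_sum_def scale_right_distrib sum.distrib)
  show "alternating_sum scale d n (scale c x) = scale c (alternating_sum scale d n x)"
    if "x \<in> V n" for x c
    using *[OF that that] by (simp add: alternating_sum_def scale_sum_right mult.commute)
qed

text \<open>
  The composite of two alternating sums runs over a rectangle, which is cut along its diagonal. The
  next lemma cancels the two triangles against each other. For the square of one differential
  this is a cancellation within a single double sum, so it holds in characteristic two as well.
\<close>

lemma alternating_double_sum_split:
  fixes F :: "nat \<Rightarrow> nat \<Rightarrow> 'b"
  shows "(\<Sum>i=1..n-1. scale ((-1) ^ (i-1)) (\<Sum>j=1..n. scale ((-1) ^ (j-1)) (F i j))) =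
    (\<Sum>(i,j)\<in>{(i,j). 1 \<le> i \<and> i < j \<and> j \<le> n}. scale ((-1) ^ (i-1 + (j-1))) (F i j)) +
    (\<Sum>(i,j)\<in>{(i,j). 1 \<le> j \<and> j \<le> i \<and> i \<le> n-1}. scale ((-1) ^ (i-1 + (j-1))) (F i j))"
proof -
  have "(\<Sum>i=1..n-1. scale ((-1) ^ (i-1)) (\<Sum>j=1..n. scale ((-1) ^ (j-1)) (F i j))) =
    (\<Sum>(i,j)\<in>{1..n-1} \<times> {1..n}. scale ((-1) ^ (i-1 + (j-1))) (F i j))"
    by (simp add: sum.cartesian_product scale_sum_right power_add)
  also have "{1..n-1} \<times> {1..n} = {(i,j). 1 \<le> i \<and> i < j \<and> j \<le> n} \<union> {(i,j). 1 \<le> j \<and> j \<le> i \<and> i \<le> n-1}"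
    by auto
  finally show ?thesis
    by (simp only:, intro sum.union_disjoint)
      (auto intro: finite_subset[of _ "{1..n} \<times> {1..n}"])
qed

text \<open>
  Sending \<open>(i, j)\<close> to \<open>(j - 1, i)\<close> is a bijection from the triangle \<open>i < j\<close> to the complementary
  triangle, and it changes the parity of \<open>i + j\<close>.
\<close>

lemma alternating_exchange:
  assumes FG: "\<And>i j. 1 \<le> i \<Longrightarrow> i < j \<Longrightarrow> j \<le> n \<Longrightarrow> F i j = G (j - 1) i"
  shows "(\<Sum>(i,j)\<in>{(i,j). 1 \<le> i \<and> i < j \<and> j \<le> n}. scale ((-1) ^ (i-1 + (j-1))) (F i j)) =
    - (\<Sum>(i,j)\<in>{(i,j). 1 \<le> j \<and> j \<le> i \<and> i \<le> n-1}. scale ((-1) ^ (i-1 + (j-1))) (G i j))"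
  unfolding sum_negf [symmetric]
proof (rule sum.reindex_bij_witness[where i = "\<lambda>(p,q). (q, p+1)" and j = "\<lambda>(i,j). (j-1, i)"], goal_cases)
  case (5 a)
  then obtain i j where a: "a = (i, j)" "1 \<le> i" "i < j" "j \<le> n" by auto
  define k l where "k = i - 1" and "l = j - 2"
  with a have "i = Suc k" "j = Suc (Suc l)" by auto
  with a FG[of i j] show ?case by (simp add: add.commute)
qed auto

lemma alternating_sum_comp:
  assumes e: "\<And>j. 1 \<le> j \<Longrightarrow> j \<le> n \<Longrightarrow> linear_map_on scale (V n) (V (n - 1)) (e n j)"
    and d: "\<And>i. 1 \<le> i \<Longrightarrow> i \<le> n - 1 \<Longrightarrow> linear_map_on scale (V (n - 1)) W (d (n - 1) i)"
    and V: "subspace (V (n - 1))" and x: "x \<in> V n"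
  shows "alternating_sum scale d (n - 1) (alternating_sum scale e n x) =
    (\<Sum>i=1..n-1. scale ((-1) ^ (i-1)) (\<Sum>j=1..n. scale ((-1) ^ (j-1)) (d (n - 1) i (e n j x))))"
  unfolding alternating_sum_def
  by (intro sum.cong refl arg_cong2[where f = scale] linear_map_on_sum[OF d V])
    (use linear_map_on_mem[OF e x] in auto)

lemma presimplicial_alternating_sum_square_zero:
  assumes d: "presimplicial scale V d" and x: "x \<in> V n"
  shows "alternating_sum scale d (n - 1) (alternating_sum scale d n x) = 0"
proof -
  let ?F = "\<lambda>i j. d (n - 1) i (d n j x)"
  have "alternating_sum scale d (n - 1) (alternating_sum scale d n x) =
    (\<Sum>i=1..n-1. scale ((-1) ^ (i-1)) (\<Sum>j=1..n. scale ((-1) ^ (j-1)) (?F i j)))"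
    by (intro alternating_sum_comp[where V = V and W = "V (n - 1 - 1)"] presimplicialD[OF d] x)
  also have "\<dots> = 0"
    unfolding alternating_double_sum_split
    using alternating_exchange[of n ?F ?F] presimplicialD(3)[OF d _ _ _ x] by simp
  finally show ?thesis .
qed

lemma pre_bisimplicial_alternating_sums_anticommute:
  assumes d: "pre_bisimplicial scale V d d'" and x: "x \<in> V n"
  shows "alternating_sum scale d (n - 1) (alternating_sum scale d' n x) =
    - alternating_sum scale d' (n - 1) (alternating_sum scale d n x)"
proof -
  have ps: "presimplicial scale V d" "presimplicial scale V d'"
    using d by (simp_all add: pre_bisimplicial_def)
  let ?F = "\<lambda>i j. d (n - 1) i (d' n j x)" and ?G = "\<lambda>i j. d' (n - 1) i (d n j x)"
  have 1: "alternating_sum scale d (n - 1) (alternating_sum scale d' n x) =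
    (\<Sum>i=1..n-1. scale ((-1) ^ (i-1)) (\<Sum>j=1..n. scale ((-1) ^ (j-1)) (?F i j)))"
    by (intro alternating_sum_comp[where V = V and W = "V (n - 1 - 1)"]
        presimplicialD(2)[OF ps(1)] presimplicialD(1,2)[OF ps(2)] x)
  have 2: "alternating_sum scale d' (n - 1) (alternating_sum scale d n x) =
    (\<Sum>i=1..n-1. scale ((-1) ^ (i-1)) (\<Sum>j=1..n. scale ((-1) ^ (j-1)) (?G i j)))"
    by (intro alternating_sum_comp[where V = V and W = "V (n - 1 - 1)"]
        presimplicialD(2)[OF ps(2)] presimplicialD(1,2)[OF ps(1)] x)
  show ?thesis
    unfolding 1 2 alternating_double_sum_split
    using alternating_exchange[of n ?F ?G] alternating_exchange[of n ?G ?F] d x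
    by (simp add: pre_bisimplicial_def)
qed

lemma degenerate_subset:
  assumes "weakly_simplicial scale V d s"
  shows "degenerate scale V s n \<subseteq> V n"
proof -
  have "subspace (V n)" by (rule presimplicialD(1)[OF weakly_simplicialD(1)[OF assms]])
  moreover have "s (n - 1) i ` V (n - 1) \<subseteq> V n" if "i \<in> {1..n - 1}" for i
  proof -
    have "linear_map_on scale (V (n - 1)) (V (n - 1 + 1)) (s (n - 1) i)"
      using weakly_simplicialD(2)[OF assms] that by simp
    then show ?thesis using that by (auto simp: linear_map_on_def)
  qed
  ultimately show ?thesis unfolding degenerate_def by (intro span_minimal UN_least)
qed

text \<open>
  A face other than the two that meet the inserted factor can be moved past the degeneracy.
\<close>

lemma weakly_simplicial_degenerate_face:
  assumes ws: "weakly_simplicial scale V d s" and y: "y \<in> V n"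
    and k: "1 \<le> k" "k \<le> n" and i: "1 \<le> i" "i \<le> n + 1" "i \<noteq> k" "i \<noteq> k + 1"
  shows "d (n + 1) i (s n k y) \<in> degenerate scale V s n"
proof -
  have dV: "d n j y \<in> V (n - 1)" if "1 \<le> j" "j \<le> n" for j
    using presimplicialD(2)[OF weakly_simplicialD(1)[OF ws]] that y by (blast intro: linear_map_on_mem)
  consider "i < k" | "k + 1 < i" using i by linarith
  then show ?thesis
  proof cases
    case 1
    then have "d (n + 1) i (s n k y) = s (n - 1) (k - 1) (d n i y)"
      using weakly_simplicialD(3)[OF ws] y k i by blast
    moreover have "d n i y \<in> V (n - 1)" using 1 k i by (intro dV) auto
    moreover have "k - 1 \<in> {1..n - 1}" using 1 k i by auto
    ultimately show ?thesis unfolding degenerate_def by (auto intro!: span_base)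
  next
    case 2
    then have "d (n + 1) i (s n k y) = s (n - 1) k (d n (i - 1) y)"
      using weakly_simplicialD(4)[OF ws] y k i by blast
    moreover have "d n (i - 1) y \<in> V (n - 1)" using 2 k i by (intro dV) auto
    moreover have "k \<in> {1..n - 1}" using 2 k i by auto
    ultimately show ?thesis unfolding degenerate_def by (auto intro!: span_base)
  qed
qed

text \<open>
  The two remaining faces agree on \<open>s n k y\<close> and have opposite signs in the alternating sum.
\<close>

lemma weakly_simplicial_degenerate_stable:
  assumes ws: "weakly_simplicial scale V d s"
  shows "alternating_sum scale d (Suc n) ` degenerate scale V s (Suc n) \<subseteq> degenerate scale V s n"
proof -
  let ?D = "degenerate scale V s n" and ?a = "alternating_sum scale d (Suc n)"
  have lin: "linear_map_on scale (V (Suc n)) (V n) ?a"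
    using presimplicialD(1,2)[OF weakly_simplicialD(1)[OF ws]]
    by (intro linear_map_on_alternating_sum) force+
  have V: "subspace (V (Suc n))"
    by (rule presimplicialD(1)[OF weakly_simplicialD(1)[OF ws]])
  have D: "subspace ?D" by (simp add: degenerate_def)
  have gen: "s n k y \<in> V (Suc n) \<and> ?a (s n k y) \<in> ?D" if k: "1 \<le> k" "k \<le> n" and y: "y \<in> V n" for k y
  proof
    show "s n k y \<in> V (Suc n)"
      using linear_map_on_mem[OF weakly_simplicialD(2)[OF ws k] y] by simp
    (* the terms k and k + 1 cancel; the others are degenerate by the previous lemma *)
    let ?t = "\<lambda>i. scale ((-1) ^ (i-1)) (d (Suc n) i (s n k y))"
    have "?a (s n k y) = sum ?t ({1..Suc n} - {k, k+1}) + sum ?t {k, k+1}"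
      unfolding alternating_sum_def by (rule sum.subset_diff) (use k in auto)
    moreover have "?t (k+1) = - ?t k"
    proof -
      have "d (n + 1) k (s n k y) = d (n + 1) (k + 1) (s n k y)"
        using weakly_simplicialD(5)[OF ws] k y by blast
      then show ?thesis using k by (cases k) auto
    qed
    ultimately have "?a (s n k y) = (\<Sum>i\<in>{1..Suc n} - {k, k+1}. ?t i)" by simp
    also have "\<dots> \<in> ?D"
      using weakly_simplicial_degenerate_face[OF ws y k]
      by (intro subspace_sum[OF D] subspace_scale[OF D]) auto
    finally show "?a (s n k y) \<in> ?D" .
  qed
  have "x \<in> V (Suc n) \<and> ?a x \<in> ?D" if "x \<in> degenerate scale V s (Suc n)" for x
    using that unfolding degenerate_def[of _ _ _ "Suc n"]
  proof (induction rule: span_induct_alt)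
    case base
    have "?a (scale 0 0) = scale 0 (?a 0)"
      using lin subspace_0[OF V] unfolding linear_map_on_def by blast
    then show ?case using subspace_0[OF V] subspace_0[OF D] by simp
  next
    case (step c x y)
    then obtain k z where "1 \<le> k" "k \<le> n" "z \<in> V n" "x = s n k z" by auto
    with gen have x: "x \<in> V (Suc n)" "?a x \<in> ?D" by auto
    then have "scale c x \<in> V (Suc n)" by (simp add: subspace_scale[OF V])
    then have "?a (scale c x + y) = scale c (?a x) + ?a y"
      using lin step x unfolding linear_map_on_def by auto
    then show ?case using step x V D \<open>scale c x \<in> _\<close>
      by (auto intro: subspace_add subspace_scale)
  qed
  then show ?thesis by auto
qed
end

section \<open>Faces, truncations and unit insertions of words\<close>

text \<open>
  The words, without their scalar coefficients, in the two families of face maps and in the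
  degeneracies. The factor \<open>\<mu>(v\<^sub>i \<otimes> v\<^bsub>i+1\<^esub>)\<close> belongs to the face map with index \<open>i + 1\<close>.
  The maps \<open>d'\<^sub>i\<close> truncate a word before its \<open>i\<close>-th letter and fill it up with units to length \<open>n - 1\<close>.
\<close>

definition face_word :: "('v \<Rightarrow> 'v \<Rightarrow> 'v) \<Rightarrow> nat \<Rightarrow> 'v list \<Rightarrow> 'v list" where
  "face_word mu i vs = (if i = 1 then tl vs else multiply_at mu (i - 1) vs)"

definition truncate_word :: "'v \<Rightarrow> nat \<Rightarrow> 'v list \<Rightarrow> 'v list" where
  "truncate_word one i vs = take (i - 1) vs @ replicate (length vs - i) one"

definition insert_unit :: "'v \<Rightarrow> nat \<Rightarrow> 'v list \<Rightarrow> 'v list" where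
  "insert_unit one i vs = take (i - 1) vs @ one # drop (i - 1) vs"

lemma length_face_word [simp]:
  "1 \<le> i \<Longrightarrow> i \<le> length vs \<Longrightarrow> length (face_word mu i vs) = length vs - 1"
  by (auto simp: face_word_def multiply_at_def)

text \<open>
  With letters counted from \<open>0\<close>, one description covers both the removal of the first letter
  (\<open>i = 1\<close>, where only the last alternative occurs) and the multiplications. Such letterwise
  descriptions turn every identity of words into linear arithmetic on positions.
\<close>

lemma nth_face_word:
  assumes "1 \<le> i" "i \<le> length vs" "Suc k < length vs"
  shows "face_word mu i vs ! k =
    (if k + 2 < i then vs ! k else if k + 2 = i then mu (vs ! k) (vs ! Suc k) else vs ! Suc k)"
  using assms by (auto simp: face_word_def multiply_at_def nth_append nth_tl min_def nth_Cons split: nat.splits)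
    (auto simp: le_less_Suc_eq less_Suc_eq intro!: arg_cong[where f = "(!) vs"] arg_cong2[where f = mu])

lemma length_truncate_word [simp]:
  "1 \<le> i \<Longrightarrow> i \<le> length vs \<Longrightarrow> length (truncate_word one i vs) = length vs - 1"
  by (auto simp: truncate_word_def)

lemma nth_truncate_word:
  assumes "1 \<le> i" "i \<le> length vs" "Suc k < length vs"
  shows "truncate_word one i vs ! k = (if k + 1 < i then vs ! k else one)"
  using assms by (auto simp: truncate_word_def nth_append min_def)

lemma length_insert_unit [simp]:
  "i \<le> length vs \<Longrightarrow> length (insert_unit one i vs) = length vs + 1"
  by (auto simp: insert_unit_def)

lemma nth_insert_unit:
  assumes "1 \<le> i" "i \<le> length vs" "k \<le> length vs"
  shows "insert_unit one i vs ! k =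
    (if k + 1 < i then vs ! k else if k + 1 = i then one else vs ! (k - 1))"
  using assms by (auto simp: insert_unit_def nth_append min_def nth_Cons split: nat.splits)
    (auto intro!: arg_cong[where f = "(!) vs"])

text \<open>
  Changing the letter at position \<open>k\<close> changes at most one letter of the result, and that letter
  depends linearly on the new one. A letter that disappears, like the one removed by the first
  face, enters the coefficient instead. The updates of the other operations have the same form.
\<close>

lemma face_word_update:
  assumes "1 \<le> i" "i \<le> length vs" "k < length vs"
  shows "k + 2 < i \<Longrightarrow> face_word mu i (vs[k := u]) = (face_word mu i vs)[k := u]"
    and "k + 2 = i \<Longrightarrow> face_word mu i (vs[k := u]) = (face_word mu i vs)[k := mu u (vs ! Suc k)]"
    and "k + 1 = i \<Longrightarrow> 1 < i \<Longrightarrow>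
      face_word mu i (vs[k := u]) = (face_word mu i vs)[k - 1 := mu (vs ! (k - 1)) u]"
    and "k = 0 \<Longrightarrow> i = 1 \<Longrightarrow> face_word mu i (vs[k := u]) = face_word mu i vs"
    and "i \<le> k \<Longrightarrow> face_word mu i (vs[k := u]) = (face_word mu i vs)[k - 1 := u]"
  by (rule nth_equalityI; use assms in \<open>auto simp: Suc_le_eq nth_face_word nth_list_update\<close>)+

lemma truncate_word_update:
  assumes "1 \<le> i" "i \<le> length vs" "k < length vs"
  shows "k + 1 < i \<Longrightarrow> truncate_word one i (vs[k := u]) = (truncate_word one i vs)[k := u]"
    and "i \<le> k + 1 \<Longrightarrow> truncate_word one i (vs[k := u]) = truncate_word one i vs"
  by (rule nth_equalityI; use assms in \<open>auto simp: nth_truncate_word nth_list_update\<close>)+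

lemma insert_unit_update:
  assumes "1 \<le> i" "i \<le> length vs" "k < length vs"
  shows "k + 1 < i \<Longrightarrow> insert_unit one i (vs[k := u]) = (insert_unit one i vs)[k := u]"
    and "i \<le> k + 1 \<Longrightarrow> insert_unit one i (vs[k := u]) = (insert_unit one i vs)[k + 1 := u]"
  by (rule nth_equalityI; use assms in \<open>auto simp: nth_insert_unit nth_list_update\<close>)+

text \<open>
  The (bi)simplicial identities for words. Associativity is needed where two faces multiply three
  adjacent letters, the right unit law where a letter is multiplied by a following unit, and the
  left unit law for the face that multiplies an inserted unit by the letter after it.
\<close>

lemma face_word_face_word:
  assumes "\<And>u v w. mu (mu u v) w = mu u (mu v w)" "1 \<le> i" "i < j" "j \<le> length vs"
  shows "face_word mu i (face_word mu j vs) = face_word mu (j - 1) (face_word mu i vs)"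
  by (rule nth_equalityI) (use assms in \<open>auto simp: nth_face_word\<close>)

lemma truncate_word_truncate_word:
  assumes "1 \<le> i" "i < j" "j \<le> length vs"
  shows "truncate_word one i (truncate_word one j vs) = truncate_word one (j - 1) (truncate_word one i vs)"
  by (rule nth_equalityI) (use assms in \<open>auto simp: nth_truncate_word\<close>)

lemma face_word_truncate_word:
  assumes "1 \<le> i" "i < j" "j \<le> length vs"
  shows "face_word mu i (truncate_word one j vs) = truncate_word one (j - 1) (face_word mu i vs)"
  by (rule nth_equalityI) (use assms in \<open>auto simp: nth_truncate_word nth_face_word\<close>)

lemma truncate_word_face_word:
  assumes "\<And>v. mu v one = v" "1 \<le> i" "i < j" "j \<le> length vs"
  shows "truncate_word one i (face_word mu j vs) = face_word mu (j - 1) (truncate_word one i vs)"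
  by (rule nth_equalityI) (use assms in \<open>auto simp: nth_truncate_word nth_face_word\<close>)

lemma insert_unit_insert_unit:
  assumes "1 \<le> i" "i \<le> j" "j \<le> length vs"
  shows "insert_unit one i (insert_unit one j vs) = insert_unit one (j + 1) (insert_unit one i vs)"
  by (rule nth_equalityI) (use assms in \<open>auto simp: nth_insert_unit\<close>)

lemma face_word_insert_unit_less:
  assumes "1 \<le> i" "i < j" "j \<le> length vs"
  shows "face_word mu i (insert_unit one j vs) = insert_unit one (j - 1) (face_word mu i vs)"
  by (rule nth_equalityI) (use assms in \<open>auto simp: nth_insert_unit nth_face_word\<close>)

lemma face_word_insert_unit_greater:
  assumes "1 \<le> j" "j + 1 < i" "i \<le> length vs + 1"
  shows "face_word mu i (insert_unit one j vs) = insert_unit one j (face_word mu (i - 1) vs)"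
  by (rule nth_equalityI) (use assms in \<open>auto simp: nth_insert_unit nth_face_word\<close>)

lemma face_word_insert_unit_same:
  assumes "\<And>v. mu v one = v" "1 \<le> i" "i \<le> length vs"
  shows "face_word mu i (insert_unit one i vs) = vs"
  by (rule nth_equalityI) (use assms in \<open>auto simp: nth_insert_unit nth_face_word\<close>)

lemma face_word_insert_unit_next:
  assumes "\<And>v. mu one v = v" "1 \<le> i" "i \<le> length vs"
  shows "face_word mu (i + 1) (insert_unit one i vs) = vs"
  by (rule nth_equalityI) (use assms in \<open>auto simp: nth_insert_unit nth_face_word\<close>)

lemma truncate_word_insert_unit_less:
  assumes "1 \<le> i" "i < j" "j \<le> length vs"
  shows "truncate_word one i (insert_unit one j vs) = insert_unit one (j - 1) (truncate_word one i vs)"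
  by (rule nth_equalityI) (use assms in \<open>auto simp: nth_insert_unit nth_truncate_word\<close>)

lemma truncate_word_insert_unit_greater:
  assumes "1 \<le> j" "j + 1 < i" "i \<le> length vs + 1"
  shows "truncate_word one i (insert_unit one j vs) = insert_unit one j (truncate_word one (i - 1) vs)"
  by (rule nth_equalityI) (use assms in \<open>auto simp: nth_insert_unit nth_truncate_word\<close>)

lemma truncate_word_insert_unit_same:
  assumes "1 \<le> i" "i \<le> length vs"
  shows "truncate_word one i (insert_unit one i vs) = truncate_word one (i + 1) (insert_unit one i vs)"
  by (rule nth_equalityI) (use assms in \<open>auto simp: nth_insert_unit nth_truncate_word\<close>)

text \<open>
  Appending a unit on the right is the contraction: it commutes with all earlier faces, and the
  last face undoes it since a right unit is absorbed by the letter on its left.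
\<close>

lemma face_word_append_less:
  assumes "1 \<le> i" "i \<le> length vs"
  shows "face_word mu i (vs @ [one]) = face_word mu i vs @ [one]"
  by (rule nth_equalityI) (use assms in \<open>auto simp: nth_append nth_face_word\<close>)

lemma face_word_append_last:
  assumes "\<And>v. mu v one = v"
  shows "face_word mu (length vs + 1) (vs @ [one]) = vs"
  by (rule nth_equalityI) (use assms in \<open>auto simp: nth_append nth_face_word\<close>)

section \<open>Operators on tensors that come from words\<close>

context tensor_algebra
begin

text \<open>
  Every structure map below sends a word to a multiple of another word. Linearity is demanded on the
  ambient space, so composites may be compared without tracking domains.
\<close>

definition word_operator :: "nat \<Rightarrow> ('v list \<Rightarrow> 'k) \<Rightarrow> ('v list \<Rightarrow> 'v list) \<Rightarrow> ('t \<Rightarrow> 't) \<Rightarrow> bool" where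
  "word_operator n c A f \<longleftrightarrow> Vector_Spaces.linear scaleT scaleT f \<and>
     (\<forall>vs. length vs = n \<longrightarrow> f (tens vs) = scaleT (c vs) (tens (A vs)))"

lemma word_operatorD:
  assumes "word_operator n c A f"
  shows "Vector_Spaces.linear scaleT scaleT f"
    and "length vs = n \<Longrightarrow> f (tens vs) = scaleT (c vs) (tens (A vs))"
  using assms by (auto simp: word_operator_def)

lemma word_operator_id: "word_operator n (\<lambda>_. 1) (\<lambda>vs. vs) id"
  unfolding word_operator_def by (auto intro!: linear_mapI T.vector_space_axioms)

lemma word_operator_linear_map_on:
  assumes f: "word_operator n c A f" and len: "\<And>vs. length vs = n \<Longrightarrow> length (A vs) = m"
  shows "linear_map_on scaleT (tensor_power scaleT tens n) (tensor_power scaleT tens m) f"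
proof -
  interpret f: Vector_Spaces.linear scaleT scaleT f by (rule word_operatorD(1)[OF f])
  have "f ` tensor_power scaleT tens n \<subseteq> tensor_power scaleT tens m"
    by (rule linear_image_power[OF word_operatorD(1)[OF f] subspace_power])
      (simp add: word_operatorD(2)[OF f] T.subspace_scale[OF subspace_power] tens_in_power len)
  then show ?thesis by (simp add: linear_map_on_def f.add f.scale)
qed

text \<open>
  Identities between composites split into an identity of words and an identity of coefficients.
\<close>

lemma word_operator_comp_eqI:
  assumes "word_operator m c A f" "word_operator n c' A' g"
    and "word_operator m' e B f'" "word_operator n e' B' g'"
    and "\<And>vs. length vs = n \<Longrightarrow> length (A' vs) = m \<and> length (B' vs) = m'"
    and "\<And>vs. length vs = n \<Longrightarrow> A (A' vs) = B (B' vs)"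
    and "\<And>vs. length vs = n \<Longrightarrow> c (A' vs) * c' vs = e (B' vs) * e' vs"
    and x: "x \<in> tensor_power scaleT tens n"
  shows "f (g x) = f' (g' x)"
proof -
  note ops = assms(1-4)
  interpret f: Vector_Spaces.linear scaleT scaleT f by (rule word_operatorD(1)[OF ops(1)])
  interpret f': Vector_Spaces.linear scaleT scaleT f' by (rule word_operatorD(1)[OF ops(3)])
  have "(f \<circ> g) x = (f' \<circ> g') x"
  proof (rule linear_eq_on_power[OF _ _ _ x])
    show "Vector_Spaces.linear scaleT scaleT (f \<circ> g)"
      by (rule Vector_Spaces.linear_compose[OF word_operatorD(1)[OF ops(2)] word_operatorD(1)[OF ops(1)]])
    show "Vector_Spaces.linear scaleT scaleT (f' \<circ> g')"
      by (rule Vector_Spaces.linear_compose[OF word_operatorD(1)[OF ops(4)] word_operatorD(1)[OF ops(3)]])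
    fix vs :: "'v list" assume n: "length vs = n"
    show "(f \<circ> g) (tens vs) = (f' \<circ> g') (tens vs)"
      using assms(5-7)[OF n] n
      by (simp add: word_operatorD(2)[OF ops(1)] word_operatorD(2)[OF ops(2)]
        word_operatorD(2)[OF ops(3)] word_operatorD(2)[OF ops(4)] f.scale f'.scale mult.commute)
  qed
  then show ?thesis by simp
qed

text \<open>
  A letter must enter exactly one of the two factors, the word or the coefficient: entering both
  would give a quadratic dependence.
\<close>

lemma multilinear_scaled_word:
  assumes slot: "\<And>vs k. length vs = n \<Longrightarrow> k < n \<Longrightarrow>
    (\<exists>k' g. k' < length (A vs) \<and> Vector_Spaces.linear scale scale g \<and>
       (\<forall>u. A (vs[k := u]) = (A vs)[k' := g u] \<and> c (vs[k := u]) = c vs)) \<or>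
    (\<exists>e. Vector_Spaces.linear scale (*) e \<and> (\<forall>u. A (vs[k := u]) = A vs \<and> c (vs[k := u]) = e u))"
  shows "multilinear scale scaleT n (\<lambda>vs. scaleT (c vs) (tens (A vs)))"
  unfolding multilinear_def
proof (intro allI impI, elim conjE)
  fix vs :: "'v list" and k assume "length vs = n" "k < n"
  from slot[OF this] show "Vector_Spaces.linear scale scaleT
      (\<lambda>u. scaleT (c (vs[k := u])) (tens (A (vs[k := u]))))"
  proof (elim disjE exE conjE)
    fix k' g assume k': "k' < length (A vs)" and g: "Vector_Spaces.linear scale scale g"
      and eq: "\<forall>u. A (vs[k := u]) = (A vs)[k' := g u] \<and> c (vs[k := u]) = c vs"
    interpret g: Vector_Spaces.linear scale scale g by (rule g)
    interpret S: Vector_Spaces.linear scale scaleT "\<lambda>u. tens ((A vs)[k' := u])"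
      using tens_multilinear k' unfolding multilinear_def by blast
    show ?thesis
      by (rule linear_mapI) (simp_all add: eq vector_space_axioms T.vector_space_axioms
          g.add g.scale S.add S.scale T.scale_right_distrib mult.commute)
  next
    fix e assume e: "Vector_Spaces.linear scale (*) e"
      and eq: "\<forall>u. A (vs[k := u]) = A vs \<and> c (vs[k := u]) = e u"
    interpret e: Vector_Spaces.linear scale "(*)" e by (rule e)
    show ?thesis
      by (rule linear_mapI) (simp_all add: eq vector_space_axioms T.vector_space_axioms
          e.add e.scale T.scale_left_distrib)
  qed
qed

text \<open>
  A choice, meaningful only where the prescription is multilinear. The structure maps defined with
  it are arbitrary for indices outside the range \<open>1 \<le> i \<le> n\<close>.
\<close>

definition lift :: "nat \<Rightarrow> ('v list \<Rightarrow> 'k) \<Rightarrow> ('v list \<Rightarrow> 'v list) \<Rightarrow> 't \<Rightarrow> 't" where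
  "lift n c A = (SOME f. word_operator n c A f)"

lemma word_operator_lift:
  assumes "multilinear scale scaleT n (\<lambda>vs. scaleT (c vs) (tens (A vs)))"
  shows "word_operator n c A (lift n c A)"
proof -
  from assms obtain L where "Vector_Spaces.linear scaleT scaleT L"
    "\<And>vs. length vs = n \<Longrightarrow> L (tens vs) = scaleT (c vs) (tens (A vs))"
    by (rule lift_multilinear) blast
  then have "word_operator n c A L" by (simp add: word_operator_def)
  then show ?thesis unfolding lift_def by (rule someI[of "word_operator n c A"])
qed

lemma linear_alternating_sum:
  assumes "\<And>i. 1 \<le> i \<Longrightarrow> i \<le> n \<Longrightarrow> Vector_Spaces.linear scaleT scaleT (d n i)"
  shows "Vector_Spaces.linear scaleT scaleT (alternating_sum scaleT d n)"
proof -
  have "d n i (x + y) = d n i x + d n i y" "d n i (scaleT c x) = scaleT c (d n i x)"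
    if "i \<in> {1..n}" for i x y c
    using assms[of i] that by (auto simp: Vector_Spaces.linear_iff)
  then show ?thesis
    by (intro linear_mapI T.vector_space_axioms)
      (simp_all add: alternating_sum_def T.scale_right_distrib sum.distrib T.scale_sum_right mult.commute)
qed

lemma linear_image_tensor_space:
  assumes f: "Vector_Spaces.linear scaleT scaleT f" and W: "T.subspace W"
    and "\<And>n. f ` tensor_power scaleT tens n \<subseteq> W"
  shows "f ` tensor_space scaleT tens \<subseteq> W"
proof -
  interpret f: Vector_Spaces.linear scaleT scaleT f by (rule f)
  have "f ` tensor_space scaleT tens = T.span (f ` (\<Union>n. tensor_power scaleT tens n))"
    by (simp only: tensor_space_eq_span_powers f.span_image)
  also have "\<dots> \<subseteq> W" using W assms(3) by (intro T.span_minimal) auto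
  finally show ?thesis .
qed

lemma power_subset_tensor_space: "tensor_power scaleT tens n \<subseteq> tensor_space scaleT tens"
  unfolding tensor_space_eq_span_powers by (auto intro: T.span_base)

text \<open>
  The identities hold in each degree by the exchange of triangles; they pass to the whole tensor
  space because that space is spanned by its graded pieces and the differentials are linear.
\<close>

lemma bicomplex_of_pre_bisimplicial:
  assumes bi: "pre_bisimplicial scaleT (tensor_power scaleT tens) d d'"
    and D: "Vector_Spaces.linear scaleT scaleT D" "Vector_Spaces.linear scaleT scaleT D'"
    and D_eq: "\<And>n x. x \<in> tensor_power scaleT tens n \<Longrightarrow> D x = alternating_sum scaleT d n x"
    and D'_eq: "\<And>n x. x \<in> tensor_power scaleT tens n \<Longrightarrow> D' x = alternating_sum scaleT d' n x"
  shows "bicomplex scaleT (tensor_power scaleT tens) (tensor_space scaleT tens) D D'"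
proof -
  let ?V = "tensor_power scaleT tens" and ?W = "tensor_space scaleT tens"
  have pre: "presimplicial scaleT ?V d" "presimplicial scaleT ?V d'"
    using bi by (simp_all add: pre_bisimplicial_def)
  have step: "E x \<in> ?V (n - 1)"
    if "presimplicial scaleT ?V e" "x \<in> ?V n"
      and "\<And>n x. x \<in> ?V n \<Longrightarrow> E x = alternating_sum scaleT e n x" for e E n x
  proof -
    have "linear_map_on scaleT (?V n) (?V (n - 1)) (alternating_sum scaleT e n)"
      by (rule T.linear_map_on_alternating_sum[OF _ subspace_power])
        (rule presimplicialD(2)[OF that(1)])
    then show ?thesis using that(2) by (simp add: that(3)[OF that(2)] linear_map_on_mem)
  qed
  have deg: "degree_minus_one scaleT ?V ?W E"
    if e: "presimplicial scaleT ?V e" and E: "Vector_Spaces.linear scaleT scaleT E"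
      and eq: "\<And>n x. x \<in> ?V n \<Longrightarrow> E x = alternating_sum scaleT e n x" for e E
  proof -
    interpret E: Vector_Spaces.linear scaleT scaleT E by (rule E)
    have "E ` ?W \<subseteq> ?W"
      using step[OF e _ eq] power_subset_tensor_space
      by (intro linear_image_tensor_space[OF E]) (auto simp: tensor_space_def)
    moreover have "E x \<in> ?V n" if "x \<in> ?V (Suc n)" for n x
      using step[OF e that eq] by simp
    moreover have "E x = 0" if "x \<in> ?V 0" for x
      using eq[OF that] by simp
    ultimately show ?thesis
      by (auto simp: degree_minus_one_def linear_map_on_def E.add E.scale)
  qed
  have vanish: "f x = 0" if f: "Vector_Spaces.linear scaleT scaleT f" and "x \<in> ?W"
    and "\<And>n x. x \<in> ?V n \<Longrightarrow> f x = 0" for f x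
    using linear_image_tensor_space[OF f, of "{0}"] that(2,3) by (auto simp: T.subspace_def)
  interpret D: Vector_Spaces.linear scaleT scaleT D by (rule D)
  interpret D': Vector_Spaces.linear scaleT scaleT D' by (rule D)
  have "D (D x) = 0 \<and> D' (D' x) = 0 \<and> D (D' x) = - D' (D x)" if "x \<in> ?W" for x
  proof -
    have "D (D y) = 0" "D' (D' y) = 0" "D (D' y) + D' (D y) = 0" if y: "y \<in> ?V n" for n y
      using step[OF pre(1) y D_eq] step[OF pre(2) y D'_eq]
        T.presimplicial_alternating_sum_square_zero[OF pre(1) y]
        T.presimplicial_alternating_sum_square_zero[OF pre(2) y]
        T.pre_bisimplicial_alternating_sums_anticommute[OF bi y]
      by (simp_all add: D_eq[OF y] D'_eq[OF y] D_eq D'_eq)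
    moreover have "Vector_Spaces.linear scaleT scaleT (\<lambda>y. D (D y))"
      "Vector_Spaces.linear scaleT scaleT (\<lambda>y. D' (D' y))"
      "Vector_Spaces.linear scaleT scaleT (\<lambda>y. D (D' y) + D' (D y))"
      by (intro linear_mapI T.vector_space_axioms;
          simp add: D.add D'.add D.scale D'.scale T.scale_right_distrib)+
    ultimately have "D (D x) = 0" "D' (D' x) = 0" "D (D' x) + D' (D x) = 0"
      using vanish[OF _ that, of "\<lambda>y. D (D y)"] vanish[OF _ that, of "\<lambda>y. D' (D' y)"]
        vanish[OF _ that, of "\<lambda>y. D (D' y) + D' (D y)"] by blast+
    then show ?thesis by (simp add: eq_neg_iff_add_eq_0)
  qed
  then show ?thesis
    using deg[OF pre(1) D(1) D_eq] deg[OF pre(2) D(2) D'_eq]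
    by (simp add: bicomplex_def graded_tensor_space)
qed

lemma reduced_class_eq_iff:
  assumes "x \<in> tensor_space scaleT tens" "y \<in> tensor_space scaleT tens"
  shows "reduced_class scaleT tens one x = reduced_class scaleT tens one y \<longleftrightarrow>
    x - y \<in> unit_tensors scaleT tens one"
proof -
  have U: "T.subspace (unit_tensors scaleT tens one)" by (simp add: unit_tensors_def)
  have x: "x \<in> reduced_class scaleT tens one x"
    using assms by (simp add: reduced_class_def T.subspace_0[OF U])
  have "z - x \<in> unit_tensors scaleT tens one \<longleftrightarrow> z - y \<in> unit_tensors scaleT tens one"
    if "x - y \<in> unit_tensors scaleT tens one" for z
    using T.subspace_add[OF U _ that, of "z - x"] T.subspace_diff[OF U _ that, of "z - y"] by auto
  with x show ?thesis by (auto simp: reduced_class_def)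
qed

text \<open>
  A class determines its representatives up to the span of the tensors with a unit factor, so any
  choice of representative gives the same value.
\<close>

lemma induced_map_on_reduced_classes:
  assumes f: "Vector_Spaces.linear scaleT scaleT f"
    and W: "f ` tensor_space scaleT tens \<subseteq> tensor_space scaleT tens"
    and U: "f ` unit_tensors scaleT tens one \<subseteq> unit_tensors scaleT tens one"
  obtains \<delta> where "\<And>x. x \<in> tensor_space scaleT tens \<Longrightarrow>
    \<delta> (reduced_class scaleT tens one x) = reduced_class scaleT tens one (f x)"
proof -
  interpret f: Vector_Spaces.linear scaleT scaleT f by (rule f)
  let ?W = "tensor_space scaleT tens" and ?c = "reduced_class scaleT tens one"
  define \<delta> where "\<delta> X = ?c (f (SOME x. x \<in> ?W \<and> X = ?c x))" for X
  have "\<delta> (?c x) = ?c (f x)" if x: "x \<in> ?W" for x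
  proof -
    define y where "y = (SOME y. y \<in> ?W \<and> ?c x = ?c y)"
    have y: "y \<in> ?W" "?c x = ?c y"
      using someI[of "\<lambda>y. y \<in> ?W \<and> ?c x = ?c y" x] x by (simp_all add: y_def)
    then have "f (y - x) \<in> unit_tensors scaleT tens one"
      using U reduced_class_eq_iff[OF y(1) x, of one] by auto
    moreover have "f y \<in> ?W" "f x \<in> ?W" using W x y by auto
    ultimately have "?c (f y) = ?c (f x)" by (simp add: reduced_class_eq_iff f.diff)
    then show ?thesis by (simp add: \<delta>_def y_def)
  qed
  then show thesis by (rule that)
qed
end

section \<open>The structure maps of an algebra with two characters\<close>

locale algebra_with_characters =
  right_unital_algebra scale mu one + tensor_algebra scale scaleT tens
  for scale :: "'k::field \<Rightarrow> 'v::ab_group_add \<Rightarrow> 'v" and mu one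
    and scaleT :: "'k \<Rightarrow> 't::ab_group_add \<Rightarrow> 't" and tens +
  fixes eps zeta :: "'v \<Rightarrow> 'k"
  assumes eps: "algebra_character scale mu one eps"
    and zeta: "algebra_character scale mu one zeta"
begin

lemma eps_mu [simp]: "eps (mu v w) = eps v * eps w"
  and eps_one [simp]: "eps one = 1"
  and zeta_mu [simp]: "zeta (mu v w) = zeta v * zeta w"
  and zeta_one [simp]: "zeta one = 1"
  using eps zeta by (auto simp: algebra_character_def)

definition face_coeff :: "nat \<Rightarrow> 'v list \<Rightarrow> 'k" where
  "face_coeff i vs = (if i = 1 then eps (vs ! 0) else 1)"

definition tail_coeff :: "nat \<Rightarrow> 'v list \<Rightarrow> 'k" where
  "tail_coeff i vs = prod_list (map zeta (drop (i - 1) vs))"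

text \<open>
  The following facts on \<open>tail_coeff\<close> say how \<open>\<zeta>(v\<^sub>i) \<dots> \<zeta>(v\<^sub>n)\<close> reacts to the word
  operations. Multiplying two adjacent letters inside the tail preserves it because \<open>\<zeta>\<close> is
  multiplicative; units in the tail are invisible because \<open>\<zeta>(\<one>) = 1\<close>.
\<close>

lemma tail_coeff_face_word_shift:
  assumes "1 \<le> i" "i < j" "j \<le> length vs"
  shows "tail_coeff (j - 1) (face_word mu i vs) = tail_coeff j vs"
proof -
  have "drop (j - 1 - 1) (face_word mu i vs) = drop (j - 1) vs"
    by (rule nth_equalityI) (use assms in \<open>auto simp: nth_face_word intro!: arg_cong[where f = "(!) vs"]\<close>)
  then show ?thesis by (simp add: tail_coeff_def)
qed

lemma tail_coeff_face_word:
  assumes "1 \<le> i" "i < j" "j \<le> length vs"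
  shows "tail_coeff i (face_word mu j vs) = tail_coeff i vs"
proof -
  define xs a b ys where "xs = take (j - 2) vs" and "a = vs ! (j - 2)" and "b = vs ! (j - 1)"
    and "ys = drop j vs"
  have Suc: "Suc (j - 2) = j - 1" "Suc (j - 1) = j" using assms by auto
  have len: "length xs = j - 2" using assms by (simp add: xs_def)
  have "drop (j - 2) vs = a # drop (j - 1) vs" "drop (j - 1) vs = b # ys"
    using assms Suc by (simp_all add: a_def b_def ys_def Cons_nth_drop_Suc[symmetric])
  then have vs: "vs = xs @ a # b # ys"
    unfolding xs_def by (metis append_take_drop_id)
  have "face_word mu j vs = xs @ mu a b # ys"
    using assms Suc by (simp add: face_word_def multiply_at_def xs_def a_def b_def ys_def numeral_2_eq_2)
  then show ?thesis using assms len by (simp add: tail_coeff_def vs mult.assoc)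
qed

lemma tail_coeff_truncate_word:
  assumes "1 \<le> i" "i \<le> j" "j \<le> length vs"
  shows "tail_coeff i (truncate_word one j vs) * tail_coeff j vs = tail_coeff i vs"
proof -
  have "drop (i - 1) vs = drop (i - 1) (take (j - 1) vs @ drop (j - 1) vs)" by simp
  also have "\<dots> = drop (i - 1) (take (j - 1) vs) @ drop (j - 1) vs"
    using assms by (subst drop_append) simp
  finally show ?thesis
    using assms by (simp add: tail_coeff_def truncate_word_def)
qed

lemma tail_coeff_truncate_word_beyond:
  assumes "i \<le> p" "i \<le> length vs"
  shows "tail_coeff p (truncate_word one i vs) = 1"
  using assms by (simp add: tail_coeff_def truncate_word_def)

lemma tail_coeff_insert_unit:
  assumes "1 \<le> i" "1 \<le> j" "j \<le> length vs"
  shows "tail_coeff i (insert_unit one j vs) = tail_coeff (if i \<le> j then i else i - 1) vs"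
proof (cases "i \<le> j")
  case True
  have "drop (i - 1) vs = drop (i - 1) (take (j - 1) vs @ drop (j - 1) vs)" by simp
  also have "\<dots> = drop (i - 1) (take (j - 1) vs) @ drop (j - 1) vs"
    using assms True by (subst drop_append) simp
  finally show ?thesis
    using assms True by (simp add: tail_coeff_def insert_unit_def)
next
  case False
  then have "i - 1 - (j - 1) = Suc (i - 1 - j)" using assms by simp
  with False show ?thesis
    using assms by (simp add: tail_coeff_def insert_unit_def)
qed

definition face :: "nat \<Rightarrow> nat \<Rightarrow> 't \<Rightarrow> 't" where
  "face n i = lift n (face_coeff i) (face_word mu i)"

definition truncation :: "nat \<Rightarrow> nat \<Rightarrow> 't \<Rightarrow> 't" where
  "truncation n i = lift n (tail_coeff i) (truncate_word one i)"

definition degeneracy :: "nat \<Rightarrow> nat \<Rightarrow> 't \<Rightarrow> 't" where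
  "degeneracy n i = lift n (\<lambda>_. 1) (insert_unit one i)"

definition append_unit :: "nat \<Rightarrow> 't \<Rightarrow> 't" where
  "append_unit n = lift n (\<lambda>_. 1) (\<lambda>vs. vs @ [one])"

lemma linear_ident: "Vector_Spaces.linear scale scale (\<lambda>u. u)"
  by (intro linear_mapI vector_space_axioms) auto

lemma face_operator:
  assumes i: "1 \<le> i" "i \<le> n"
  shows "word_operator n (face_coeff i) (face_word mu i) (face n i)"
  unfolding face_def
proof (intro word_operator_lift multilinear_scaled_word)
  fix vs :: "'v list" and k assume len: "length vs = n" and k: "k < n"
  note upd = face_word_update[of i vs k, unfolded len, OF i k]
  consider "k + 2 < i" | "k + 2 = i" | "k + 1 = i" "1 < i" | "k = 0" "i = 1" | "i \<le> k"
    using i by linarith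
  then show "(\<exists>k' g. k' < length (face_word mu i vs) \<and> Vector_Spaces.linear scale scale g \<and>
       (\<forall>u. face_word mu i (vs[k := u]) = (face_word mu i vs)[k' := g u] \<and>
         face_coeff i (vs[k := u]) = face_coeff i vs)) \<or>
    (\<exists>e. Vector_Spaces.linear scale (*) e \<and>
       (\<forall>u. face_word mu i (vs[k := u]) = face_word mu i vs \<and> face_coeff i (vs[k := u]) = e u))"
  proof cases
    case 1
    then show ?thesis using upd(1)[OF 1] i k len
      by (intro disjI1 exI[of _ k] exI[of _ "\<lambda>u. u"]) (simp add: face_coeff_def linear_ident)
  next
    case 2
    then show ?thesis using upd(2)[OF 2] i k len linear_left
      by (intro disjI1 exI[of _ k] exI[of _ "\<lambda>u. mu u (vs ! Suc k)"]) (auto simp add: face_coeff_def)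
  next
    case 3
    then show ?thesis using upd(3)[OF 3] i k len linear_right
      by (intro disjI1 exI[of _ "k - 1"] exI[of _ "mu (vs ! (k - 1))"]) (auto simp add: face_coeff_def)
  next
    case 4
    then show ?thesis using upd(4)[OF 4] i k len eps
      by (intro disjI2 exI[of _ eps]) (simp add: face_coeff_def algebra_character_def)
  next
    case 5
    then show ?thesis using upd(5)[OF 5] i k len
      by (intro disjI1 exI[of _ "k - 1"] exI[of _ "\<lambda>u. u"]) (auto simp add: face_coeff_def linear_ident)
  qed
qed

text \<open>
  A letter in the part that is replaced by units survives only through its value under \<open>\<zeta>\<close>.
\<close>

lemma tail_coeff_update:
  assumes "1 \<le> i" "i \<le> k + 1" "k < length vs"
  shows "\<exists>a. \<forall>u. tail_coeff i (vs[k := u]) = a * zeta u"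
proof -
  define ws m where "ws = drop (i - 1) vs" and "m = k - (i - 1)"
  have m: "m < length ws" using assms by (simp add: ws_def m_def)
  have "drop (i - 1) (vs[k := u]) = ws[m := u]" for u
    using assms by (simp add: ws_def m_def drop_update_swap)
  then have "tail_coeff i (vs[k := u]) =
      prod_list (map zeta (take m ws)) * prod_list (map zeta (drop (Suc m) ws)) * zeta u" for u
    by (simp only: tail_coeff_def upd_conv_take_nth_drop[OF m]) (simp add: mult_ac)
  then show ?thesis by blast
qed

lemma truncation_operator:
  assumes i: "1 \<le> i" "i \<le> n"
  shows "word_operator n (tail_coeff i) (truncate_word one i) (truncation n i)"
  unfolding truncation_def
proof (intro word_operator_lift multilinear_scaled_word)
  fix vs :: "'v list" and k assume len: "length vs = n" and k: "k < n"
  note upd = truncate_word_update[of i vs k, unfolded len, OF i k]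
  show "(\<exists>k' g. k' < length (truncate_word one i vs) \<and> Vector_Spaces.linear scale scale g \<and>
       (\<forall>u. truncate_word one i (vs[k := u]) = (truncate_word one i vs)[k' := g u] \<and>
         tail_coeff i (vs[k := u]) = tail_coeff i vs)) \<or>
    (\<exists>e. Vector_Spaces.linear scale (*) e \<and>
       (\<forall>u. truncate_word one i (vs[k := u]) = truncate_word one i vs \<and> tail_coeff i (vs[k := u]) = e u))"
  proof (cases "k + 1 < i")
    case True
    then show ?thesis using upd(1)[OF True] i k len
      by (intro disjI1 exI[of _ k] exI[of _ "\<lambda>u. u"]) (simp add: tail_coeff_def linear_ident)
  next
    case False
    then have ik: "i \<le> k + 1" by simp
    have "\<exists>a. \<forall>u. tail_coeff i (vs[k := u]) = a * zeta u"
      using k len by (intro tail_coeff_update[OF i(1) ik]) simp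
    then obtain a where a: "\<forall>u. tail_coeff i (vs[k := u]) = a * zeta u" ..
    have "Vector_Spaces.linear scale (*) (\<lambda>u. a * zeta u)"
      using zeta unfolding algebra_character_def Vector_Spaces.linear_iff
      by (simp add: distrib_left mult.left_commute)
    then show ?thesis using upd(2)[OF ik] a
      by (intro disjI2 exI[of _ "\<lambda>u. a * zeta u"]) simp
  qed
qed

lemma degeneracy_operator:
  assumes i: "1 \<le> i" "i \<le> n"
  shows "word_operator n (\<lambda>_. 1) (insert_unit one i) (degeneracy n i)"
  unfolding degeneracy_def
proof (intro word_operator_lift multilinear_scaled_word disjI1)
  fix vs :: "'v list" and k assume len: "length vs = n" and k: "k < n"
  note upd = insert_unit_update[of i vs k, unfolded len, OF i k]
  show "\<exists>k' g. k' < length (insert_unit one i vs) \<and> Vector_Spaces.linear scale scale g \<and>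
       (\<forall>u. insert_unit one i (vs[k := u]) = (insert_unit one i vs)[k' := g u] \<and> (1::'k) = 1)"
    using upd i k len
    by (intro exI[of _ "if k + 1 < i then k else k + 1"] exI[of _ "\<lambda>u. u"]) (auto simp: linear_ident)
qed

lemma append_unit_operator: "word_operator n (\<lambda>_. 1) (\<lambda>vs. vs @ [one]) (append_unit n)"
  unfolding append_unit_def
proof (intro word_operator_lift multilinear_scaled_word disjI1)
  fix vs :: "'v list" and k assume "length vs = n" "k < n"
  then have "vs[k := u] @ [one] = (vs @ [one])[k := u]" "k < length (vs @ [one])" for u
    by (simp_all add: list_update_append1)
  then show "\<exists>k' g. k' < length (vs @ [one]) \<and> Vector_Spaces.linear scale scale g \<and>
       (\<forall>u. vs[k := u] @ [one] = (vs @ [one])[k' := g u] \<and> (1::'k) = 1)"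
    by (intro exI[of _ k] exI[of _ "\<lambda>u. u"]) (simp add: linear_ident)
qed

section \<open>The pre-bisimplicial structure\<close>

abbreviation V where "V \<equiv> tensor_power scaleT tens"

lemma presimplicial_face: "presimplicial scaleT V face"
  unfolding presimplicial_def
proof (intro conjI allI impI ballI subspace_power; elim conjE)
  fix n i :: nat assume "1 \<le> i" "i \<le> n"
  then show "linear_map_on scaleT (V n) (V (n - 1)) (face n i)"
    by (intro word_operator_linear_map_on[OF face_operator]) auto
next
  fix n i j :: nat and x assume ij: "1 \<le> i" "i < j" "j \<le> n" and x: "x \<in> V n"
  then have i': "i \<le> n - 1" "i \<le> n" "1 \<le> j" "1 \<le> j - 1" "j - 1 \<le> n - 1" by auto
  show "face (n - 1) i (face n j x) = face (n - 1) (j - 1) (face n i x)"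
    by (rule word_operator_comp_eqI[OF face_operator[OF ij(1) i'(1)] face_operator[OF i'(3) ij(3)]
          face_operator[OF i'(4,5)] face_operator[OF ij(1) i'(2)] _ _ _ x])
      (use ij i' in \<open>auto simp: face_word_face_word assoc face_coeff_def nth_face_word\<close>)
qed

lemma presimplicial_truncation: "presimplicial scaleT V truncation"
  unfolding presimplicial_def
proof (intro conjI allI impI ballI subspace_power; elim conjE)
  fix n i :: nat assume "1 \<le> i" "i \<le> n"
  then show "linear_map_on scaleT (V n) (V (n - 1)) (truncation n i)"
    by (intro word_operator_linear_map_on[OF truncation_operator]) auto
next
  fix n i j :: nat and x assume ij: "1 \<le> i" "i < j" "j \<le> n" and x: "x \<in> V n"
  then have i': "i \<le> n - 1" "i \<le> n" "1 \<le> j" "1 \<le> j - 1" "j - 1 \<le> n - 1" by auto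
  show "truncation (n - 1) i (truncation n j x) = truncation (n - 1) (j - 1) (truncation n i x)"
    by (rule word_operator_comp_eqI[OF truncation_operator[OF ij(1) i'(1)] truncation_operator[OF i'(3) ij(3)]
          truncation_operator[OF i'(4,5)] truncation_operator[OF ij(1) i'(2)] _ _ _ x])
      (use ij i' in \<open>auto simp: truncate_word_truncate_word tail_coeff_truncate_word
        tail_coeff_truncate_word_beyond\<close>)
qed

text \<open>
  In \<open>d'\<^sub>i d\<^sub>j = d\<^bsub>j-1\<^esub> d'\<^sub>i\<close> the right-hand face meets a unit produced by \<open>d'\<^sub>i\<close>: it multiplies
  some letter by that unit, or, for \<open>i = 1\<close> and \<open>j = 2\<close>, removes the unit with the factor
  \<open>\<epsilon>(\<one>) = 1\<close>.
\<close>

lemma pre_bisimplicial_face_truncation: "pre_bisimplicial scaleT V face truncation"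
  unfolding pre_bisimplicial_def
proof (intro conjI allI impI ballI presimplicial_face presimplicial_truncation; elim conjE)
  fix n i j :: nat and x assume ij: "1 \<le> i" "i < j" "j \<le> n" and x: "x \<in> V n"
  then have i': "i \<le> n - 1" "i \<le> n" "1 \<le> j" "1 \<le> j - 1" "j - 1 \<le> n - 1" by auto
  show "face (n - 1) i (truncation n j x) = truncation (n - 1) (j - 1) (face n i x)"
    by (rule word_operator_comp_eqI[OF face_operator[OF ij(1) i'(1)] truncation_operator[OF i'(3) ij(3)]
          truncation_operator[OF i'(4,5)] face_operator[OF ij(1) i'(2)] _ _ _ x])
      (use ij i' in \<open>auto simp: face_word_truncate_word tail_coeff_face_word_shift[unfolded One_nat_def]
        face_coeff_def nth_truncate_word\<close>)
  show "truncation (n - 1) i (face n j x) = face (n - 1) (j - 1) (truncation n i x)"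
    by (rule word_operator_comp_eqI[OF truncation_operator[OF ij(1) i'(1)] face_operator[OF i'(3) ij(3)]
          face_operator[OF i'(4,5)] truncation_operator[OF ij(1) i'(2)] _ _ _ x])
      (use ij i' in \<open>auto simp: truncate_word_face_word right_unit tail_coeff_face_word
        face_coeff_def nth_truncate_word\<close>)
qed

lemma face_tens:
  "length vs = n \<Longrightarrow> 1 \<le> i \<Longrightarrow> i \<le> n \<Longrightarrow>
    face n i (tens vs) = scaleT (face_coeff i vs) (tens (face_word mu i vs))"
  by (rule word_operatorD(2)[OF face_operator]) auto

lemma truncation_tens:
  "length vs = n \<Longrightarrow> 1 \<le> i \<Longrightarrow> i \<le> n \<Longrightarrow>
    truncation n i (tens vs) = scaleT (tail_coeff i vs) (tens (truncate_word one i vs))"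
  by (rule word_operatorD(2)[OF truncation_operator]) auto

lemma degeneracy_tens:
  "length vs = n \<Longrightarrow> 1 \<le> i \<Longrightarrow> i \<le> n \<Longrightarrow>
    degeneracy n i (tens vs) = tens (insert_unit one i vs)"
  by (subst word_operatorD(2)[OF degeneracy_operator]) auto

lemma append_unit_tens: "length vs = n \<Longrightarrow> append_unit n (tens vs) = tens (vs @ [one])"
  by (subst word_operatorD(2)[OF append_unit_operator]) auto

section \<open>The two differentials\<close>

text \<open>
  The two differentials glue the alternating sums in all degrees; on the tensor space they are thereby
  determined.
\<close>

definition face_differential :: "'t \<Rightarrow> 't" where
  "face_differential = (SOME D. Vector_Spaces.linear scaleT scaleT D \<and>
     (\<forall>n. \<forall>x\<in>V n. D x = alternating_sum scaleT face n x))"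

definition truncation_differential :: "'t \<Rightarrow> 't" where
  "truncation_differential = (SOME D. Vector_Spaces.linear scaleT scaleT D \<and>
     (\<forall>n. \<forall>x\<in>V n. D x = alternating_sum scaleT truncation n x))"

lemma total_differential_exists:
  assumes "\<And>n i. 1 \<le> i \<Longrightarrow> i \<le> n \<Longrightarrow> Vector_Spaces.linear scaleT scaleT (d n i)"
  shows "\<exists>D. Vector_Spaces.linear scaleT scaleT D \<and>
     (\<forall>n. \<forall>x\<in>V n. D x = alternating_sum scaleT d n x)"
proof -
  have "Vector_Spaces.linear scaleT scaleT (alternating_sum scaleT d n)" for n
    using assms by (rule linear_alternating_sum)
  then obtain D where "Vector_Spaces.linear scaleT scaleT D"
    "\<And>n x. x \<in> V n \<Longrightarrow> D x = alternating_sum scaleT d n x"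
    by (rule glue_linear[where F = "alternating_sum scaleT d"]) (erule that, blast)
  then show ?thesis by (intro exI[of _ D]) simp
qed

lemma face_differential:
  shows linear_face_differential: "Vector_Spaces.linear scaleT scaleT face_differential"
    and face_differential_eq: "x \<in> V n \<Longrightarrow> face_differential x = alternating_sum scaleT face n x"
proof -
  have "\<exists>D. Vector_Spaces.linear scaleT scaleT D \<and>
      (\<forall>n. \<forall>x\<in>V n. D x = alternating_sum scaleT face n x)"
    by (rule total_differential_exists) (rule word_operatorD(1)[OF face_operator])
  from someI_ex[OF this, folded face_differential_def]
  show "Vector_Spaces.linear scaleT scaleT face_differential"
    and "x \<in> V n \<Longrightarrow> face_differential x = alternating_sum scaleT face n x"
    by simp_all
qed

lemma truncation_differential:
  shows linear_truncation_differential: "Vector_Spaces.linear scaleT scaleT truncation_differential"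
    and truncation_differential_eq:
      "x \<in> V n \<Longrightarrow> truncation_differential x = alternating_sum scaleT truncation n x"
proof -
  have "\<exists>D. Vector_Spaces.linear scaleT scaleT D \<and>
      (\<forall>n. \<forall>x\<in>V n. D x = alternating_sum scaleT truncation n x)"
    by (rule total_differential_exists) (rule word_operatorD(1)[OF truncation_operator])
  from someI_ex[OF this, folded truncation_differential_def]
  show "Vector_Spaces.linear scaleT scaleT truncation_differential"
    and "x \<in> V n \<Longrightarrow> truncation_differential x = alternating_sum scaleT truncation n x"
    by simp_all
qed

lemma bicomplex_face_truncation:
  "bicomplex scaleT V (tensor_space scaleT tens) face_differential truncation_differential"
  by (rule bicomplex_of_pre_bisimplicial[OF pre_bisimplicial_face_truncation
        linear_face_differential linear_truncation_differential
        face_differential_eq truncation_differential_eq])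

section \<open>Acyclicity\<close>

lemma face_append_unit:
  assumes "1 \<le> i" "i \<le> n" "x \<in> V n"
  shows "face (n + 1) i (append_unit n x) = append_unit (n - 1) (face n i x)"
proof (rule word_operator_comp_eqI[OF face_operator append_unit_operator append_unit_operator
      face_operator[OF assms(1,2)] _ _ _ assms(3)])
  fix vs :: "'v list" assume "length vs = n"
  then show "length (vs @ [one]) = n + 1 \<and> length (face_word mu i vs) = n - 1"
    "face_word mu i (vs @ [one]) = face_word mu i vs @ [one]"
    "face_coeff i (vs @ [one]) * 1 = 1 * face_coeff i vs"
    using assms by (auto simp: face_word_append_less face_coeff_def nth_append)
qed (use assms in auto)

lemma last_face_append_unit:
  assumes "x \<in> V n"
  shows "face (n + 1) (n + 1) (append_unit n x) = x"
proof -
  have "face (n + 1) (n + 1) (append_unit n x) = id (id x)"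
  proof (rule word_operator_comp_eqI[OF face_operator append_unit_operator word_operator_id
        word_operator_id _ _ _ assms])
    fix vs :: "'v list" assume "length vs = n"
    then show "length (vs @ [one]) = n + 1 \<and> length vs = n"
      "face_word mu (n + 1) (vs @ [one]) = vs"
      "face_coeff (n + 1) (vs @ [one]) * 1 = 1 * 1"
      using face_word_append_last[where mu = mu and one = one and vs = vs] right_unit
      by (auto simp: face_coeff_def)
  qed auto
  then show ?thesis by simp
qed

lemma append_unit_in_power: "x \<in> V n \<Longrightarrow> append_unit n x \<in> V (Suc n)"
  by (rule linear_map_on_mem[OF word_operator_linear_map_on[OF append_unit_operator]]) auto

text \<open>
  All faces but the last commute with \<open>append_unit\<close>, and the last contributes \<open>x\<close> with the sign of
  the index \<open>n + 1\<close>. In degree zero the last face is the first one, and \<open>\<epsilon>(\<one>) = 1\<close> is what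
  makes it undo \<open>append_unit\<close>.
\<close>

lemma append_unit_homotopy:
  assumes x: "x \<in> V n"
  shows "face_differential (append_unit n x) =
    append_unit (n - 1) (face_differential x) + scaleT ((-1) ^ n) x"
proof -
  interpret h: Vector_Spaces.linear scaleT scaleT "append_unit (n - 1)"
    by (rule word_operatorD(1)[OF append_unit_operator])
  have "face_differential (append_unit n x) =
      (\<Sum>i=1..n+1. scaleT ((-1) ^ (i - 1)) (face (n + 1) i (append_unit n x)))"
    using face_differential_eq[OF append_unit_in_power[OF x]] by (simp add: alternating_sum_def)
  also have "\<dots> = (\<Sum>i=1..n. scaleT ((-1) ^ (i - 1)) (face (n + 1) i (append_unit n x)))
      + scaleT ((-1) ^ n) x"
    using last_face_append_unit[OF x] by simp
  also have "(\<Sum>i=1..n. scaleT ((-1) ^ (i - 1)) (face (n + 1) i (append_unit n x))) =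
      (\<Sum>i=1..n. append_unit (n - 1) (scaleT ((-1) ^ (i - 1)) (face n i x)))"
    using face_append_unit[OF _ _ x] by (intro sum.cong) (auto simp: h.scale[unfolded One_nat_def])
  also have "\<dots> = append_unit (n - 1) (face_differential x)"
    by (simp add: face_differential_eq[OF x] alternating_sum_def h.sum[unfolded One_nat_def])
  finally show ?thesis .
qed

text \<open>
  By the homotopy formula, a cycle \<open>x\<close> of degree \<open>n\<close> is the boundary of \<open>(-1)\<^sup>n\<close> times \<open>x \<one>\<close>.
\<close>

lemma acyclic_face_differential: "acyclic_complex V face_differential"
  unfolding acyclic_complex_def
proof (intro allI equalityI subsetI)
  fix n x assume "x \<in> {x \<in> V n. face_differential x = 0}"
  then have x: "x \<in> V n" "face_differential x = 0" by auto
  interpret h: Vector_Spaces.linear scaleT scaleT "append_unit (n - 1)"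
    by (rule word_operatorD(1)[OF append_unit_operator])
  interpret D: Vector_Spaces.linear scaleT scaleT face_differential
    by (rule linear_face_differential)
  have "face_differential (scaleT ((-1) ^ n) (append_unit n x)) = scaleT ((-1) ^ n * (-1) ^ n) x"
    using append_unit_homotopy[OF x(1)] by (simp add: D.scale x(2) h.zero[unfolded One_nat_def])
  also have "\<dots> = x" by (simp flip: power_mult_distrib)
  finally have "face_differential (scaleT ((-1) ^ n) (append_unit n x)) = x" .
  then show "x \<in> face_differential ` V (Suc n)"
    by (rule image_eqI[OF sym])
      (intro T.subspace_scale[OF subspace_power] append_unit_in_power x)
next
  fix n x assume "x \<in> face_differential ` V (Suc n)"
  then obtain y where y: "y \<in> V (Suc n)" "x = face_differential y" by auto
  then show "x \<in> {x \<in> V n. face_differential x = 0}"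
    using bicomplex_face_truncation power_subset_tensor_space[of "Suc n"]
    by (auto simp: bicomplex_def degree_minus_one_def)
qed

section \<open>The differentials on pure tensors\<close>

lemma face_differential_tens:
  assumes "1 \<le> length vs"
  shows "face_differential (tens vs) = scaleT (eps (hd vs)) (tens (tl vs)) +
    (\<Sum>i\<in>{1..length vs - 1}. scaleT ((-1) ^ i) (tens (multiply_at mu i vs)))"
proof -
  define m where "m = length vs - 1"
  have m: "length vs = Suc m" using assms by (simp add: m_def)
  have split: "(\<Sum>i=1..Suc m. g i) = g 1 + (\<Sum>i=1..m. g (Suc i))" for g :: "nat \<Rightarrow> 't"
    using sum.atLeast_Suc_atMost[of 1 "Suc m" g] sum.shift_bounds_cl_Suc_ivl[of g 1 m] by simp
  have "face_differential (tens vs) =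
      (\<Sum>i=1..Suc m. scaleT ((-1) ^ (i - 1)) (face (length vs) i (tens vs)))"
    by (simp add: face_differential_eq[OF tens_in_power[OF refl]] alternating_sum_def m)
  also have "\<dots> = (\<Sum>i=1..Suc m. scaleT ((-1) ^ (i - 1) * face_coeff i vs) (tens (face_word mu i vs)))"
    by (intro sum.cong refl) (simp add: face_tens m)
  also have "\<dots> = scaleT (eps (vs ! 0)) (tens (tl vs)) +
      (\<Sum>i=1..m. scaleT ((-1) ^ i) (tens (multiply_at mu i vs)))"
    unfolding split by (simp add: face_coeff_def face_word_def)
  finally show ?thesis using m by (cases vs) (auto simp: m_def)
qed

lemma last_truncation_tens:
  assumes "1 \<le> length vs"
  shows "truncation (length vs) (length vs) (tens vs) = scaleT (zeta (last vs)) (tens (butlast vs))"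
proof -
  from assms obtain ws w where "vs = ws @ [w]" by (cases vs rule: rev_cases) auto
  then show ?thesis using assms by (simp add: truncation_tens tail_coeff_def truncate_word_def)
qed

lemma truncation_differential_tens:
  assumes "1 \<le> length vs"
  shows "truncation_differential (tens vs) =
    scaleT ((-1) ^ (length vs - 1) * zeta (last vs)) (tens (butlast vs)) +
    (\<Sum>i\<in>{0..<length vs - 1}. scaleT ((-1) ^ i * prod_list (map zeta (drop i vs)))
       (tens (take i vs @ replicate (length vs - 1 - i) one)))"
proof -
  define m where "m = length vs - 1"
  have m: "length vs = Suc m" using assms by (simp add: m_def)
  have "truncation_differential (tens vs) =
      (\<Sum>i=1..Suc m. scaleT ((-1) ^ (i - 1)) (truncation (length vs) i (tens vs)))"
    by (simp add: truncation_differential_eq[OF tens_in_power[OF refl]] alternating_sum_def m)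
  also have "\<dots> = (\<Sum>i=1..m. scaleT ((-1) ^ (i - 1)) (truncation (length vs) i (tens vs))) +
      scaleT ((-1) ^ m * zeta (last vs)) (tens (butlast vs))"
    using last_truncation_tens[OF assms] by (simp add: m)
  also have "(\<Sum>i=1..m. scaleT ((-1) ^ (i - 1)) (truncation (length vs) i (tens vs))) =
      (\<Sum>i\<in>{0..<m}. scaleT ((-1) ^ i * prod_list (map zeta (drop i vs)))
       (tens (take i vs @ replicate (m - i) one)))"
    by (rule sum.reindex_bij_witness[where i = Suc and j = "\<lambda>i. i - 1"])
      (auto simp: truncation_tens tail_coeff_def truncate_word_def m)
  finally show ?thesis by (simp add: m add.commute)
qed

lemma differentials_empty_word:
  "face_differential (tens []) = 0" "truncation_differential (tens []) = 0"
  using face_differential_eq[of "tens []" 0] truncation_differential_eq[of "tens []" 0]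
  by (simp_all add: tens_in_power)

section \<open>Degeneracies\<close>

lemma linear_map_on_degeneracy: "1 \<le> i \<Longrightarrow> i \<le> n \<Longrightarrow> linear_map_on scaleT (V n) (V (n + 1)) (degeneracy n i)"
  by (rule word_operator_linear_map_on[OF degeneracy_operator]) auto

lemma degeneracy_degeneracy:
  assumes ij: "1 \<le> i" "i \<le> j" "j \<le> n" and x: "x \<in> V n"
  shows "degeneracy (n + 1) i (degeneracy n j x) = degeneracy (n + 1) (j + 1) (degeneracy n i x)"
proof -
  have i': "i \<le> n" "1 \<le> j" "i \<le> n + 1" "1 \<le> j + 1" "j + 1 \<le> n + 1" using ij by auto
  show ?thesis
    by (rule word_operator_comp_eqI[OF degeneracy_operator[OF ij(1) i'(3)] degeneracy_operator[OF i'(2) ij(3)]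
          degeneracy_operator[OF i'(4,5)] degeneracy_operator[OF ij(1) i'(1)] _ _ _ x])
      (use ij i' in \<open>auto simp: insert_unit_insert_unit\<close>)
qed

lemma weakly_simplicial_truncation: "weakly_simplicial scaleT V truncation degeneracy"
  unfolding weakly_simplicial_def
proof (intro conjI allI impI ballI presimplicial_truncation linear_map_on_degeneracy
    degeneracy_degeneracy; elim conjE)
  fix n i j :: nat and x assume ij: "1 \<le> i" "i < j" "j \<le> n" and x: "x \<in> V n"
  then have i': "i \<le> n + 1" "i \<le> n" "1 \<le> j" "1 \<le> j - 1" "j - 1 \<le> n - 1" by auto
  show "truncation (n + 1) i (degeneracy n j x) = degeneracy (n - 1) (j - 1) (truncation n i x)"
    by (rule word_operator_comp_eqI[OF truncation_operator[OF ij(1) i'(1)] degeneracy_operator[OF i'(3) ij(3)]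
          degeneracy_operator[OF i'(4,5)] truncation_operator[OF ij(1) i'(2)] _ _ _ x])
      (use ij i' in \<open>auto simp: truncate_word_insert_unit_less tail_coeff_insert_unit\<close>)
next
  fix n i j :: nat and x assume ij: "1 \<le> j" "j + 1 < i" "i \<le> n + 1" and x: "x \<in> V n"
  then have i': "1 \<le> i" "j \<le> n" "j \<le> n - 1" "1 \<le> i - 1" "i - 1 \<le> n" by auto
  show "truncation (n + 1) i (degeneracy n j x) = degeneracy (n - 1) j (truncation n (i - 1) x)"
    by (rule word_operator_comp_eqI[OF truncation_operator[OF i'(1) ij(3)] degeneracy_operator[OF ij(1) i'(2)]
          degeneracy_operator[OF ij(1) i'(3)] truncation_operator[OF i'(4,5)] _ _ _ x])
      (use ij i' in \<open>auto simp: truncate_word_insert_unit_greater tail_coeff_insert_unit\<close>)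
next
  fix n i :: nat and x assume i: "1 \<le> i" "i \<le> n" and x: "x \<in> V n"
  then have i': "i \<le> n + 1" "1 \<le> i + 1" "i + 1 \<le> n + 1" by auto
  show "truncation (n + 1) i (degeneracy n i x) = truncation (n + 1) (i + 1) (degeneracy n i x)"
    by (rule word_operator_comp_eqI[OF truncation_operator[OF i(1) i'(1)] degeneracy_operator[OF i]
          truncation_operator[OF i'(2,3)] degeneracy_operator[OF i] _ _ _ x])
      (use i i' in \<open>auto simp: truncate_word_insert_unit_same tail_coeff_insert_unit\<close>)
qed auto

lemma face_degeneracy_same:
  assumes unit: "\<And>v. mu one v = v" and i: "1 \<le> i" "i \<le> n" and x: "x \<in> V n"
  shows "face (n + 1) i (degeneracy n i x) = x" "face (n + 1) (i + 1) (degeneracy n i x) = x"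
proof -
  have i': "i \<le> n + 1" "1 \<le> i + 1" "i + 1 \<le> n + 1" using i by auto
  have "face (n + 1) i (degeneracy n i x) = id (id x)"
    by (rule word_operator_comp_eqI[OF face_operator[OF i(1) i'(1)] degeneracy_operator[OF i]
          word_operator_id word_operator_id _ _ _ x])
      (use i in \<open>auto simp: right_unit face_word_insert_unit_same face_coeff_def nth_insert_unit\<close>)
  then show "face (n + 1) i (degeneracy n i x) = x" by simp
  have "face (n + 1) (i + 1) (degeneracy n i x) = id (id x)"
    by (rule word_operator_comp_eqI[OF face_operator[OF i'(2,3)] degeneracy_operator[OF i]
          word_operator_id word_operator_id _ _ _ x])
      (use i face_word_insert_unit_next[of mu one] in \<open>auto simp: unit face_coeff_def\<close>)
  then show "face (n + 1) (i + 1) (degeneracy n i x) = x" by simp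
qed

lemma simplicial_face:
  assumes unit: "\<And>v. mu one v = v"
  shows "simplicial scaleT V face degeneracy"
  unfolding simplicial_def weakly_simplicial_def
proof (intro conjI allI impI ballI presimplicial_face linear_map_on_degeneracy
    degeneracy_degeneracy; elim conjE)
  fix n i j :: nat and x assume ij: "1 \<le> i" "i < j" "j \<le> n" and x: "x \<in> V n"
  then have i': "i \<le> n + 1" "i \<le> n" "1 \<le> j" "1 \<le> j - 1" "j - 1 \<le> n - 1" by auto
  show "face (n + 1) i (degeneracy n j x) = degeneracy (n - 1) (j - 1) (face n i x)"
    by (rule word_operator_comp_eqI[OF face_operator[OF ij(1) i'(1)] degeneracy_operator[OF i'(3) ij(3)]
          degeneracy_operator[OF i'(4,5)] face_operator[OF ij(1) i'(2)] _ _ _ x])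
      (use ij i' in \<open>auto simp: face_word_insert_unit_less face_coeff_def nth_insert_unit\<close>)
next
  fix n i j :: nat and x assume ij: "1 \<le> j" "j + 1 < i" "i \<le> n + 1" and x: "x \<in> V n"
  then have i': "1 \<le> i" "j \<le> n" "j \<le> n - 1" "1 \<le> i - 1" "i - 1 \<le> n" by auto
  show "face (n + 1) i (degeneracy n j x) = degeneracy (n - 1) j (face n (i - 1) x)"
    by (rule word_operator_comp_eqI[OF face_operator[OF i'(1) ij(3)] degeneracy_operator[OF ij(1) i'(2)]
          degeneracy_operator[OF ij(1) i'(3)] face_operator[OF i'(4,5)] _ _ _ x])
      (use ij i' in \<open>auto simp: face_word_insert_unit_greater face_coeff_def\<close>)
next
  fix n i :: nat and x assume i: "1 \<le> i" "i \<le> n" and x: "x \<in> V n"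
  show "face (n + 1) i (degeneracy n i x) = face (n + 1) (i + 1) (degeneracy n i x)"
    and "face (n + 1) i (degeneracy n i x) = x"
    using face_degeneracy_same[OF unit i x] by simp_all
qed auto

lemma weakly_bisimplicial_face_truncation:
  assumes unit: "\<And>v. mu one v = v"
  shows "weakly_bisimplicial scaleT V face truncation degeneracy"
  using simplicial_face[OF unit] weakly_simplicial_truncation pre_bisimplicial_face_truncation
  by (simp add: weakly_bisimplicial_def simplicial_def)

lemma degenerate_sub_bicomplex:
  assumes unit: "\<And>v. mu one v = v"
  shows "sub_bicomplex scaleT V (degenerate scaleT V degeneracy) face_differential truncation_differential"
proof -
  have ws: "weakly_simplicial scaleT V face degeneracy" "weakly_simplicial scaleT V truncation degeneracy"
    using simplicial_face[OF unit] weakly_simplicial_truncation by (simp_all add: simplicial_def)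
  have sub: "degenerate scaleT V degeneracy n \<subseteq> V n" for n
    by (rule T.degenerate_subset[OF ws(1)])
  show ?thesis
    unfolding sub_bicomplex_def
  proof (intro allI conjI sub)
    fix n
    show "T.subspace (degenerate scaleT V degeneracy n)" by (simp add: degenerate_def)
    have "face_differential ` degenerate scaleT V degeneracy (Suc n) =
        alternating_sum scaleT face (Suc n) ` degenerate scaleT V degeneracy (Suc n)"
      by (intro image_cong refl face_differential_eq) (use sub in auto)
    then show "face_differential ` degenerate scaleT V degeneracy (Suc n) \<subseteq> degenerate scaleT V degeneracy n"
      using T.weakly_simplicial_degenerate_stable[OF ws(1)] by simp
    have "truncation_differential ` degenerate scaleT V degeneracy (Suc n) =
        alternating_sum scaleT truncation (Suc n) ` degenerate scaleT V degeneracy (Suc n)"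
      by (intro image_cong refl truncation_differential_eq) (use sub in auto)
    then show "truncation_differential ` degenerate scaleT V degeneracy (Suc n) \<subseteq> degenerate scaleT V degeneracy n"
      using T.weakly_simplicial_degenerate_stable[OF ws(2)] by simp
  qed
qed

lemma insert_unit_degenerate:
  assumes "1 \<le> i" "i \<le> length vs"
  shows "tens (insert_unit one i vs) \<in> degenerate scaleT V degeneracy (Suc (length vs))"
proof -
  have "tens (insert_unit one i vs) \<in> degeneracy (length vs) i ` V (length vs)"
    using assms by (intro image_eqI[where x = "tens vs"]) (simp_all add: degeneracy_tens tens_in_power)
  then show ?thesis
    unfolding degenerate_def using assms by (intro T.span_base UN_I[of i]) auto
qed

text \<open>
  For \<open>i < n - 1\<close> the truncated word ends with at least two units. The last position of a
  degenerate word is never the inserted one, so a single final unit would not suffice.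
\<close>

lemma truncation_degenerate:
  assumes i: "1 \<le> i" "i < n - 1"
  shows "truncation n i ` V n \<subseteq> degenerate scaleT V degeneracy (n - 1)"
proof (rule linear_image_power)
  have le: "i \<le> n" using i by simp
  show "Vector_Spaces.linear scaleT scaleT (truncation n i)"
    by (rule word_operatorD(1)[OF truncation_operator[OF i(1) le]])
  show D: "T.subspace (degenerate scaleT V degeneracy (n - 1))" by (simp add: degenerate_def)
  fix vs :: "'v list" assume n: "length vs = n"
  define ws where "ws = take (i - 1) vs @ replicate (n - 1 - i) one"
  have len: "length ws = n - 2" using i n by (simp add: ws_def)
  have "n - i = Suc (n - 1 - i)" using i by simp
  then have "truncate_word one i vs = insert_unit one i ws"
    using i n by (simp add: truncate_word_def insert_unit_def ws_def)
  moreover have "tens (insert_unit one i ws) \<in> degenerate scaleT V degeneracy (Suc (length ws))"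
    using i len by (intro insert_unit_degenerate) auto
  moreover have "Suc (length ws) = n - 1" using i len by simp
  ultimately have "tens (truncate_word one i vs) \<in> degenerate scaleT V degeneracy (n - 1)" by simp
  then show "truncation n i (tens vs) \<in> degenerate scaleT V degeneracy (n - 1)"
    using truncation_tens[OF n i(1) le] T.subspace_scale[OF D] by simp
qed

section \<open>The differential on reduced tensors\<close>

abbreviation U where "U \<equiv> unit_tensors scaleT tens one"

lemma subspace_U: "T.subspace U"
  by (simp add: unit_tensors_def)

lemma tens_in_U: "one \<in> set vs \<Longrightarrow> tens vs \<in> U"
  unfolding unit_tensors_def by (intro T.span_base) auto

lemma degenerate_subset_U: "degenerate scaleT V degeneracy n \<subseteq> U"
  unfolding degenerate_def
proof (intro T.span_minimal UN_least subspace_U)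
  fix i assume i: "i \<in> {1..n - 1}"
  then have op: "word_operator (n - 1) (\<lambda>_. 1) (insert_unit one i) (degeneracy (n - 1) i)"
    by (intro degeneracy_operator) auto
  show "degeneracy (n - 1) i ` V (n - 1) \<subseteq> U"
    by (rule linear_image_power[OF word_operatorD(1)[OF op] subspace_U])
      (use word_operatorD(2)[OF op] in \<open>simp add: tens_in_U insert_unit_def\<close>)
qed

lemma append_unit_in_U: "append_unit n ` V n \<subseteq> U"
  by (rule linear_image_power[OF word_operatorD(1)[OF append_unit_operator] subspace_U])
    (simp add: word_operatorD(2)[OF append_unit_operator] tens_in_U)

lemma truncation_differential_mod_U:
  assumes "1 \<le> length vs"
  shows "truncation_differential (tens vs) -
    scaleT ((-1) ^ (length vs - 1) * zeta (last vs)) (tens (butlast vs)) \<in> U"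
  unfolding truncation_differential_tens[OF assms]
  by (simp, intro T.subspace_sum[OF subspace_U] T.subspace_scale[OF subspace_U] tens_in_U) auto

text \<open>
  A word with a unit before its last position is degenerate, and both differentials preserve the
  degenerate tensors. On a word \<open>w \<one>\<close> with \<open>w\<close> of length \<open>n\<close>, each of the two differentials
  contains the term \<open>(-1)\<^sup>n w\<close>, in which the unit is gone; in their difference this term cancels,
  and all others still contain a unit.
\<close>

lemma total_differential_unit_tensors:
  assumes unit: "\<And>v. mu one v = v"
  shows "(\<lambda>x. face_differential x - truncation_differential x) ` U \<subseteq> U"
proof -
  let ?D = "\<lambda>x. face_differential x - truncation_differential x"
  interpret f: Vector_Spaces.linear scaleT scaleT face_differential
    by (rule linear_face_differential)
  interpret t: Vector_Spaces.linear scaleT scaleT truncation_differential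
    by (rule linear_truncation_differential)
  interpret D: Vector_Spaces.linear scaleT scaleT ?D
    by (intro linear_mapI T.vector_space_axioms)
      (simp_all add: f.add t.add f.scale t.scale T.scale_right_diff_distrib)
  have gen: "?D (tens vs) \<in> U" if "one \<in> set vs" for vs
  proof -
    obtain xs ys where vs: "vs = xs @ one # ys" using \<open>one \<in> set vs\<close> by (auto simp: in_set_conv_decomp)
    show ?thesis
    proof (cases "ys = []")
      case False
      let ?Dg = "degenerate scaleT V degeneracy"
      have "insert_unit one (Suc (length xs)) (xs @ ys) = vs" by (simp add: vs insert_unit_def)
      then have "tens vs \<in> ?Dg (Suc (length (xs @ ys)))"
        using insert_unit_degenerate[of "Suc (length xs)" "xs @ ys"] False by (cases ys) auto
      then have "face_differential (tens vs) \<in> ?Dg (length (xs @ ys))"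
        "truncation_differential (tens vs) \<in> ?Dg (length (xs @ ys))"
        using degenerate_sub_bicomplex[OF unit] unfolding sub_bicomplex_def by blast+
      then show ?thesis
        using degenerate_subset_U by (intro T.subspace_diff[OF subspace_U]) blast+
    next
      case True
      let ?n = "length xs" and ?x = "tens xs"
      have x: "?x \<in> V ?n" by (simp add: tens_in_power)
      have "face_differential (tens vs) = append_unit (?n - 1) (face_differential ?x) + scaleT ((-1) ^ ?n) ?x"
        using append_unit_homotopy[OF x] by (simp add: append_unit_tens vs True)
      moreover have "append_unit (?n - 1) (face_differential ?x) \<in> U"
      proof (cases ?n)
        case 0
        interpret h: Vector_Spaces.linear scaleT scaleT "append_unit 0"
          by (rule word_operatorD(1)[OF append_unit_operator])
        from 0 show ?thesis
          by (simp add: differentials_empty_word h.zero T.subspace_0[OF subspace_U])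
      next
        case (Suc m)
        then have "face_differential ?x \<in> V (?n - 1)"
          using bicomplex_face_truncation x by (auto simp: bicomplex_def degree_minus_one_def)
        then show ?thesis using append_unit_in_U by auto
      qed
      moreover have "truncation_differential (tens vs) - scaleT ((-1) ^ ?n) ?x \<in> U"
        using truncation_differential_mod_U[of vs] by (simp add: vs True)
      ultimately show ?thesis
        using T.subspace_diff[OF subspace_U, of "append_unit (?n - 1) (face_differential ?x)"
          "truncation_differential (tens vs) - scaleT ((-1) ^ ?n) ?x"]
        by (simp add: algebra_simps)
    qed
  qed
  have "?D ` U = T.span (?D ` tens ` {vs. one \<in> set vs})"
    by (simp only: unit_tensors_def D.span_image)
  also have "\<dots> \<subseteq> U" using gen by (intro T.span_minimal subspace_U) auto
  finally show ?thesis .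
qed

text \<open>
  All terms of the second differential except the last contain a unit, hence vanish in the quotient.
  The sign of the surviving term is \<open>-(-1)\<^bsup>n-1\<^esup> = (-1)\<^sup>n\<close>.
\<close>

lemma normalized_differential:
  assumes unit: "\<And>v. mu one v = v"
  obtains \<delta> where
    "\<And>x. x \<in> tensor_space scaleT tens \<Longrightarrow> \<delta> (reduced_class scaleT tens one x) =
       reduced_class scaleT tens one (face_differential x - truncation_differential x)"
    "\<And>x. x \<in> tensor_space scaleT tens \<Longrightarrow>
       \<delta> (\<delta> (reduced_class scaleT tens one x)) = reduced_class scaleT tens one 0"
    "\<And>vs. 1 \<le> length vs \<Longrightarrow> \<delta> (reduced_class scaleT tens one (tens vs)) =
       reduced_class scaleT tens one (face_differential (tens vs) +
         scaleT ((-1) ^ length vs * zeta (last vs)) (tens (butlast vs)))"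
proof -
  let ?W = "tensor_space scaleT tens" and ?c = "reduced_class scaleT tens one"
  let ?f = face_differential and ?t = truncation_differential
  let ?D = "\<lambda>x. ?f x - ?t x"
  interpret f: Vector_Spaces.linear scaleT scaleT ?f by (rule linear_face_differential)
  interpret t: Vector_Spaces.linear scaleT scaleT ?t by (rule linear_truncation_differential)
  have lin: "Vector_Spaces.linear scaleT scaleT ?D"
    by (intro linear_mapI T.vector_space_axioms)
      (simp_all add: f.add t.add f.scale t.scale T.scale_right_diff_distrib)
  have W: "T.subspace ?W" by (simp add: tensor_space_def)
  have fW: "?f x \<in> ?W" and tW: "?t x \<in> ?W" and zero: "?D (?D x) = 0" if "x \<in> ?W" for x
    using bicomplex_face_truncation that
    by (auto simp: bicomplex_def degree_minus_one_def f.diff t.diff dest: linear_map_on_mem)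
  have DW: "?D x \<in> ?W" if "x \<in> ?W" for x
    using fW[OF that] tW[OF that] by (rule T.subspace_diff[OF W])
  then obtain \<delta> where \<delta>: "\<And>x. x \<in> ?W \<Longrightarrow> \<delta> (?c x) = ?c (?D x)"
    using induced_map_on_reduced_classes[OF lin _ total_differential_unit_tensors[OF unit]] by blast
  show thesis
  proof (rule that[of \<delta>])
    show "\<delta> (?c x) = ?c (?D x)" if "x \<in> ?W" for x using \<delta>[OF that] .
    show "\<delta> (\<delta> (?c x)) = ?c 0" if "x \<in> ?W" for x
      using \<delta>[OF that] \<delta>[OF DW[OF that]] zero[OF that] by simp
    fix vs :: "'v list" assume vs: "1 \<le> length vs"
    have tens_W: "tens us \<in> ?W" for us unfolding tensor_space_def by (intro T.span_base) auto
    let ?l = "scaleT ((-1) ^ length vs * zeta (last vs)) (tens (butlast vs))"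
    have l: "?l = - scaleT ((-1) ^ (length vs - 1) * zeta (last vs)) (tens (butlast vs))"
      using vs by (cases vs) auto
    have "- (?t (tens vs) + ?l) \<in> U"
      using T.subspace_neg[OF subspace_U truncation_differential_mod_U[OF vs]] unfolding l by simp
    moreover have "?D (tens vs) - (?f (tens vs) + ?l) = - (?t (tens vs) + ?l)" by simp
    ultimately have "?c (?D (tens vs)) = ?c (?f (tens vs) + ?l)"
      by (subst reduced_class_eq_iff)
        (simp_all add: DW tens_W T.subspace_add[OF W] fW T.subspace_scale[OF W])
    then show "\<delta> (?c (tens vs)) = ?c (?f (tens vs) + ?l)" by (simp add: \<delta> tens_W)
  qed
qed

end

section \<open>The bicomplex and its normalization\<close>

theorem proposition4p25:
  fixes scale :: "'k::field \<Rightarrow> 'v::ab_group_add \<Rightarrow> 'v"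
    and mu :: "'v \<Rightarrow> 'v \<Rightarrow> 'v" and one :: 'v
    and eps zeta :: "'v \<Rightarrow> 'k"
    and scaleT :: "'k \<Rightarrow> 't::ab_group_add \<Rightarrow> 't" and tens :: "'v list \<Rightarrow> 't"
  assumes algebra: "right_unital_algebra scale mu one"
    and eps: "algebra_character scale mu one eps"
    and zeta: "algebra_character scale mu one zeta"
    and tensors: "tensor_algebra scale scaleT tens"
  shows "\<exists>eps_d d_zeta d d'.
    \<comment> \<open>(1)\<close>
    eps_d (tens []) = 0 \<and> d_zeta (tens []) = 0 \<and>
    (\<forall>n\<ge>1. \<forall>vs. length vs = n \<longrightarrow>
      eps_d (tens vs) =
        scaleT (eps (hd vs)) (tens (tl vs)) +
        (\<Sum>i\<in>{1..n - 1}. scaleT ((-1) ^ i) (tens (multiply_at mu i vs)))) \<and>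
    (\<forall>n\<ge>1. \<forall>vs. length vs = n \<longrightarrow>
      d_zeta (tens vs) =
        scaleT ((-1) ^ (n - 1) * zeta (last vs)) (tens (butlast vs)) +
        (\<Sum>i\<in>{0..<n - 1}. scaleT ((-1) ^ i * prod_list (map zeta (drop i vs)))
                           (tens (take i vs @ replicate (n - 1 - i) one)))) \<and>
    bicomplex scaleT (tensor_power scaleT tens) (tensor_space scaleT tens) eps_d d_zeta \<and>
    \<comment> \<open>(2)\<close>
    (\<forall>n\<ge>1. \<forall>vs. length vs = n \<longrightarrow>
      d n 1 (tens vs) = scaleT (eps (hd vs)) (tens (tl vs)) \<and>
      (\<forall>i\<in>{1..n - 1}. d n (i + 1) (tens vs) = tens (multiply_at mu i vs)) \<and>
      (\<forall>i\<in>{1..n - 1}. d' n i (tens vs) =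
        scaleT (prod_list (map zeta (drop (i - 1) vs)))
          (tens (take (i - 1) vs @ replicate (n - i) one))) \<and>
      d' n n (tens vs) = scaleT (zeta (last vs)) (tens (butlast vs))) \<and>
    pre_bisimplicial scaleT (tensor_power scaleT tens) d d' \<and>
    (\<forall>n. \<forall>x\<in>tensor_power scaleT tens n. eps_d x = alternating_sum scaleT d n x \<and>
                 d_zeta x = alternating_sum scaleT d' n x) \<and>
    \<comment> \<open>(3)\<close>
    acyclic_complex (tensor_power scaleT tens) eps_d \<and>
    ((\<forall>v. mu one v = v) \<longrightarrow>
      (\<exists>s.
        (\<forall>n vs. length vs = n \<longrightarrow> (\<forall>i\<in>{1..n}.
          s n i (tens vs) = tens (take (i - 1) vs @ one # drop (i - 1) vs))) \<and>
        \<comment> \<open>(4)\<close>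
        weakly_bisimplicial scaleT (tensor_power scaleT tens) d d' s \<and>
        \<comment> \<open>(5)\<close>
        simplicial scaleT (tensor_power scaleT tens) d s \<and>
        \<comment> \<open>(6)\<close>
        sub_bicomplex scaleT (tensor_power scaleT tens) (degenerate scaleT (tensor_power scaleT tens) s) eps_d d_zeta \<and>
        (\<forall>n i. 1 \<le> i \<and> i < n - 1 \<longrightarrow> d' n i ` tensor_power scaleT tens n \<subseteq> degenerate scaleT (tensor_power scaleT tens) s (n - 1))) \<and>
      \<comment> \<open>(7)\<close>
      (\<exists>\<delta>.
        (\<forall>x\<in>(tensor_space scaleT tens). \<delta> (reduced_class scaleT tens one x) = reduced_class scaleT tens one (eps_d x - d_zeta x)) \<and>
        (\<forall>x\<in>(tensor_space scaleT tens). \<delta> (\<delta> (reduced_class scaleT tens one x)) = reduced_class scaleT tens one 0) \<and>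
        \<delta> (reduced_class scaleT tens one (tens [])) = reduced_class scaleT tens one 0 \<and>
        (\<forall>n\<ge>1. \<forall>vs. length vs = n \<longrightarrow>
          \<delta> (reduced_class scaleT tens one (tens vs)) = reduced_class scaleT tens one (
            scaleT (eps (hd vs)) (tens (tl vs)) +
            (\<Sum>i\<in>{1..n - 1}. scaleT ((-1) ^ i) (tens (multiply_at mu i vs))) +
            scaleT ((-1) ^ n * zeta (last vs)) (tens (butlast vs))))))"
proof -
  interpret algebra_with_characters scale mu one scaleT tens eps zeta
    using algebra tensors eps zeta
    by (simp add: algebra_with_characters_def algebra_with_characters_axioms_def)
  have faces: "face n 1 (tens vs) = scaleT (eps (hd vs)) (tens (tl vs)) \<and>
      (\<forall>i\<in>{1..n - 1}. face n (i + 1) (tens vs) = tens (multiply_at mu i vs)) \<and>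
      (\<forall>i\<in>{1..n - 1}. truncation n i (tens vs) =
        scaleT (prod_list (map zeta (drop (i - 1) vs)))
          (tens (take (i - 1) vs @ replicate (n - i) one))) \<and>
      truncation n n (tens vs) = scaleT (zeta (last vs)) (tens (butlast vs))"
    if n: "1 \<le> n" "length vs = n" for n vs
  proof (intro conjI ballI)
    have "vs \<noteq> []" using n by auto
    then show "face n 1 (tens vs) = scaleT (eps (hd vs)) (tens (tl vs))"
      using n by (simp add: face_tens face_coeff_def face_word_def hd_conv_nth)
    show "face n (i + 1) (tens vs) = tens (multiply_at mu i vs)" if "i \<in> {1..n - 1}" for i
    proof -
      have "1 \<le> i" "i + 1 \<le> n" using that by auto
      then show ?thesis using n by (simp add: face_tens face_coeff_def face_word_def)
    qed
    show "truncation n i (tens vs) = scaleT (prod_list (map zeta (drop (i - 1) vs)))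
          (tens (take (i - 1) vs @ replicate (n - i) one))" if "i \<in> {1..n - 1}" for i
    proof -
      have "1 \<le> i" "i \<le> n" using that by auto
      then show ?thesis using n by (simp add: truncation_tens tail_coeff_def truncate_word_def)
    qed
    show "truncation n n (tens vs) = scaleT (zeta (last vs)) (tens (butlast vs))"
      using last_truncation_tens[of vs] n by simp
  qed
  have simplicial_structure: "(\<exists>s.
        (\<forall>n vs. length vs = n \<longrightarrow> (\<forall>i\<in>{1..n}.
          s n i (tens vs) = tens (take (i - 1) vs @ one # drop (i - 1) vs))) \<and>
        weakly_bisimplicial scaleT V face truncation s \<and>
        simplicial scaleT V face s \<and>
        sub_bicomplex scaleT V (degenerate scaleT V s) face_differential truncation_differential \<and>
        (\<forall>n i. 1 \<le> i \<and> i < n - 1 \<longrightarrow> truncation n i ` V n \<subseteq> degenerate scaleT V s (n - 1)))"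
    (is ?simplicial)
    and normalized: "(\<exists>\<delta>.
        (\<forall>x\<in>(tensor_space scaleT tens). \<delta> (reduced_class scaleT tens one x) =
          reduced_class scaleT tens one (face_differential x - truncation_differential x)) \<and>
        (\<forall>x\<in>(tensor_space scaleT tens). \<delta> (\<delta> (reduced_class scaleT tens one x)) = reduced_class scaleT tens one 0) \<and>
        \<delta> (reduced_class scaleT tens one (tens [])) = reduced_class scaleT tens one 0 \<and>
        (\<forall>n\<ge>1. \<forall>vs. length vs = n \<longrightarrow>
          \<delta> (reduced_class scaleT tens one (tens vs)) = reduced_class scaleT tens one (
            scaleT (eps (hd vs)) (tens (tl vs)) +
            (\<Sum>i\<in>{1..n - 1}. scaleT ((-1) ^ i) (tens (multiply_at mu i vs))) +
            scaleT ((-1) ^ n * zeta (last vs)) (tens (butlast vs)))))"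
    (is ?normalized)
    if unit: "\<forall>v. mu one v = v"
  proof -
    show ?simplicial
      by (intro exI[of _ degeneracy] conjI allI impI ballI weakly_bisimplicial_face_truncation
          simplicial_face degenerate_sub_bicomplex truncation_degenerate)
        (use unit in \<open>auto simp: degeneracy_tens insert_unit_def\<close>)
    have "mu one v = v" for v using unit by simp
    from normalized_differential[OF this] obtain \<delta> where
      \<delta>: "\<And>x. x \<in> tensor_space scaleT tens \<Longrightarrow> \<delta> (reduced_class scaleT tens one x) =
         reduced_class scaleT tens one (face_differential x - truncation_differential x)"
      "\<And>x. x \<in> tensor_space scaleT tens \<Longrightarrow>
         \<delta> (\<delta> (reduced_class scaleT tens one x)) = reduced_class scaleT tens one 0"
      "\<And>vs. 1 \<le> length vs \<Longrightarrow> \<delta> (reduced_class scaleT tens one (tens vs)) =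
         reduced_class scaleT tens one (face_differential (tens vs) +
           scaleT ((-1) ^ length vs * zeta (last vs)) (tens (butlast vs)))"
      by blast
    have "tens [] \<in> tensor_space scaleT tens"
      unfolding tensor_space_def by (intro T.span_base) auto
    then have "\<delta> (reduced_class scaleT tens one (tens [])) = reduced_class scaleT tens one 0"
      using \<delta>(1)[of "tens []"] by (simp add: differentials_empty_word)
    then show ?normalized
      using \<delta> by (intro exI[of _ \<delta>]) (simp add: face_differential_tens)
  qed
  have differentials: "\<forall>n. \<forall>x\<in>V n. face_differential x = alternating_sum scaleT face n x \<and>
      truncation_differential x = alternating_sum scaleT truncation n x"
    by (simp add: face_differential_eq truncation_differential_eq)
  show ?thesis
    apply (rule exI[of _ face_differential], rule exI[of _ truncation_differential],
        rule exI[of _ face], rule exI[of _ truncation],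
        intro conjI differentials_empty_word bicomplex_face_truncation
          pre_bisimplicial_face_truncation differentials acyclic_face_differential)
    subgoal by (simp add: face_differential_tens)
    subgoal by (simp add: truncation_differential_tens)
    subgoal using faces by blast
    subgoal by (intro impI conjI simplicial_structure normalized)
    done
qed

end
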